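(* Let $q\ge 3$ be a prime power. Then there exist at least $q$ pairwise non-isomorphic strongly regular graphs that are cospectral with the collinearity graph of the symplectic generalized quadrangle $W(q)$ and that are not geometric.
   Context: The symplectic generalized quadrangle $W(q)$: let $S=\begin{bmatrix}0&1&0&0\\-1&0&0&0\\0&0&0&1\\0&0&-1&0\end{bmatrix}$ over $\mathbb{F}_q$. A line of the projective space $\mathrm{PG}(3,q)$ is totally isotropic if $u^{\top}Sv=0$ for all $u,v$ on the line. $W(q)$ is the point-line incidence structure whose points are all points of $\mathrm{PG}(3,q)$ and whose lines are the totally isotropic lines; it is a generalized quadrangle of order $(q,q)$. Its collinearity graph has the points as vertices, two distinct points being adjacent if some line of $W(q)$ contains both; it is strongly regular with parameters $(q^3+q^2+q+1,q^2+q,q-1,q+1)$. Two graphs are cospectral if their adjacency matrices have the same spectrum. A strongly regular graph is geometric if it is the point graph (collinearity graph) of a partial geometry $\mathrm{pg}(s,t,\alpha)$, i.e. of a partial linear space with $s+1$ points on each line, $t+1$ lines through each point, such that for every point $x$ and line $L$ not incident with $x$ exactly $\alpha\ge1$ points of $L$ are collinear with $x$ (a generalized quadrangle of order $(s,t)$ is a $\mathrm{pg}(s,t,1)$). *)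

theory Defs
  imports
    "HOL-Analysis.Cartesian_Space"
    "HOL-Number_Theory.Prime_Powers"
    "Jordan_Normal_Form.Char_Poly"
    "Graph_Theory.Graph_Theory"
begin

text \<open>Finite simple graphs are the \<^locale>\<open>pair_graph\<close>s of the Graph Theory library: an
  undirected edge is a pair of opposite arcs.\<close>

subsection \<open>Partial geometries and their collinearity graphs\<close>

text \<open>An incidence structure is a set \<open>P\<close> of points with a set \<open>L\<close> of lines, each line being the
  set of points incident with it. For partial linear spaces this loses nothing: a line has at
  least two points and two points lie on at most one line, so lines are determined by their
  points.\<close>

definition partial_linear_space :: "'v set \<Rightarrow> 'v set set \<Rightarrow> bool" where
  "partial_linear_space P L \<longleftrightarrow>
     (\<forall>l\<in>L. l \<subseteq> P \<and> (\<exists>x\<in>l. \<exists>y\<in>l. x \<noteq> y)) \<and>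
     (\<forall>x\<in>P. \<forall>y\<in>P. x \<noteq> y \<longrightarrow>
        (\<forall>l\<in>L. \<forall>m\<in>L. x \<in> l \<and> y \<in> l \<and> x \<in> m \<and> y \<in> m \<longrightarrow> l = m))"

definition collinear_points :: "'v set set \<Rightarrow> 'v \<Rightarrow> 'v \<Rightarrow> bool" where
  "collinear_points L x y \<longleftrightarrow> (\<exists>l\<in>L. x \<in> l \<and> y \<in> l)"

definition partial_geometry ::
    "nat \<Rightarrow> nat \<Rightarrow> nat \<Rightarrow> 'v set \<Rightarrow> 'v set set \<Rightarrow> bool" where
  "partial_geometry s t \<alpha> P L \<longleftrightarrow>
     partial_linear_space P L \<and>
     (\<forall>l\<in>L. card l = s + 1) \<and>
     (\<forall>x\<in>P. card {l \<in> L. x \<in> l} = t + 1) \<and>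
     \<alpha> \<ge> 1 \<and>
     (\<forall>x\<in>P. \<forall>l\<in>L. x \<notin> l \<longrightarrow> card {y \<in> l. collinear_points L x y} = \<alpha>)"

definition collinearity_graph :: "'v set \<Rightarrow> 'v set set \<Rightarrow> 'v pair_pre_digraph" where
  "collinearity_graph P L =
     \<lparr> pverts = P, parcs = {(x, y). x \<in> P \<and> y \<in> P \<and> x \<noteq> y \<and> collinear_points L x y} \<rparr>"

text \<open>Being a point graph is invariant under isomorphism, so the points of the geometry
  may be taken to be the vertices themselves.\<close>

definition geometric :: "'v pair_pre_digraph \<Rightarrow> bool" where
  "geometric G \<longleftrightarrow>
     (\<exists>L s t \<alpha>. partial_geometry s t \<alpha> (pverts G) L \<and> G = collinearity_graph (pverts G) L)"

subsection \<open>Strongly regular graphs and cospectrality\<close>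

text \<open>The bounds on \<open>k\<close> exclude edgeless and complete graphs, as is customary.\<close>

definition srg :: "nat \<Rightarrow> nat \<Rightarrow> nat \<Rightarrow> nat \<Rightarrow> 'v pair_pre_digraph \<Rightarrow> bool" where
  "srg n k l m G \<longleftrightarrow>
     pair_graph G \<and>
     card (pverts G) = n \<and> 0 < k \<and> k < n - 1 \<and>
     (\<forall>x\<in>pverts G. card (parcs G `` {x}) = k) \<and>
     (\<forall>x\<in>pverts G. \<forall>y\<in>pverts G. x \<noteq> y \<longrightarrow>
        card (parcs G `` {x} \<inter> parcs G `` {y}) = (if (x, y) \<in> parcs G then l else m))"

definition strongly_regular :: "'v pair_pre_digraph \<Rightarrow> bool" where
  "strongly_regular G \<longleftrightarrow> (\<exists>n k l m. srg n k l m G)"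

definition adjacency_mat :: "'v list \<Rightarrow> 'v pair_pre_digraph \<Rightarrow> complex mat" where
  "adjacency_mat vs G =
     mat (length vs) (length vs) (\<lambda>(i, j). if (vs ! i, vs ! j) \<in> parcs G then 1 else 0)"

text \<open>The spectrum is the multiset of eigenvalues of the adjacency matrix, with algebraic
  multiplicities. The matrix is formed with respect to an arbitrary enumeration of the vertices;
  other enumerations give similar matrices and hence the same spectrum.\<close>

definition adjacency_spectrum :: "'v pair_pre_digraph \<Rightarrow> complex multiset" where
  "adjacency_spectrum G =
     proots (char_poly (adjacency_mat (SOME vs. distinct vs \<and> set vs = pverts G) G))"

definition cospectral :: "'v pair_pre_digraph \<Rightarrow> 'w pair_pre_digraph \<Rightarrow> bool" where
  "cospectral G H \<longleftrightarrow> adjacency_spectrum G = adjacency_spectrum H"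

abbreviation isomorphic_graphs :: "'v pair_pre_digraph \<Rightarrow> 'w pair_pre_digraph \<Rightarrow> bool" where
  "isomorphic_graphs G H \<equiv> digraph_iso (with_proj G) (with_proj H)"

subsection \<open>The symplectic generalized quadrangle\<close>

text \<open>A point or line of \<open>PG(3,q)\<close> is a subspace of dimension 1 or 2 of the vector
  space of dimension 4 over the field \<open>'a\<close> with \<open>q\<close> elements; incidence is inclusion.\<close>

definition symplectic_form_matrix :: "'a::field^4^4" where
  "symplectic_form_matrix =
     vector [vector [ 0, 1,  0, 0],
             vector [-1, 0,  0, 0],
             vector [ 0, 0,  0, 1],
             vector [ 0, 0, -1, 0]]"

definition pg3_points :: "('a::field^4) set set" where
  "pg3_points = {U. vec.subspace U \<and> vec.dim U = 1}"

definition pg3_lines :: "('a::field^4) set set" where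
  "pg3_lines = {W. vec.subspace W \<and> vec.dim W = 2}"

definition totally_isotropic :: "('a::field^4) set \<Rightarrow> bool" where
  "totally_isotropic W \<longleftrightarrow>
     (\<forall>u\<in>W. \<forall>v\<in>W. scalar_product u (symplectic_form_matrix *v v) = 0)"

definition W_lines :: "('a::field^4) set set set" where
  "W_lines = {{U \<in> pg3_points. U \<subseteq> W} | W. W \<in> pg3_lines \<and> totally_isotropic W}"

definition W_graph :: "('a::field^4) set pair_pre_digraph" where
  "W_graph = collinearity_graph pg3_points W_lines"

end

theory Submission
  imports Defs "Jordan_Normal_Form.Schur_Decomposition"
begin

no_notation vec_index (infixl "$" 100)

text \<open>
Fix the line \<open>{p\<^sub>i}\<close> of \<open>W(q)\<close>, where \<open>i\<close> runs over the field and one further index. Every other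
point is collinear with exactly one \<open>p\<^sub>i\<close>, and the points collinear with \<open>p\<^sub>i\<close> form, off the line, an
affine plane \<open>S\<^sub>i\<close> of order \<open>q\<close> whose \<open>q + 1\<close> parallel classes are again indexed by the \<open>p\<^sub>j\<close>. The
\<open>i\<close>-th class of \<open>S\<^sub>i\<close> consists of lines of \<open>W(q)\<close>, and the neighbours in \<open>S\<^sub>j\<close> of a point of \<open>S\<^sub>i\<close> form a
line of the \<open>i\<close>-th class of \<open>S\<^sub>j\<close> that depends only on the line of the \<open>j\<close>-th class of \<open>S\<^sub>i\<close> through that
point. So \<open>W(q)\<close> is given by bijections between the \<open>j\<close>-th class of \<open>S\<^sub>i\<close> and the \<open>i\<close>-th class of \<open>S\<^sub>j\<close>.
As Wallis and Fon-Der-Flaass observed, such a gluing has the same strongly regular parameters for every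
choice of these bijections: with reflexive adjacency all neighbourhoods have \<open>q\<^sup>2 + q + 1\<close> elements and
two of them always share \<open>q + 1\<close> (\<open>card_glue_neighbours\<close>, \<open>card_glue_common_neighbours\<close>). The parameters
determine the spectrum (\<open>srg_same_parameters_cospectral\<close>), so all these graphs are cospectral with \<open>W(q)\<close>.

To tell the graphs apart, say that an edge spans a line if its end points and their common neighbours form
a clique, and that a vertex is locally linear if all its edges span lines. A geometric graph with these
parameters comes from a generalized quadrangle, and there every vertex is locally linear; a single vertex
that is not refutes geometricity (\<open>not_geometric_polarity_graph\<close>). Now alter a single bijection of \<open>W(q)\<close> by
a permutation \<open>\<pi>\<close> of the field other than the identity. Exactly the \<open>q + 1\<close> points \<open>p\<^sub>i\<close>, and those points of
the two planes concerned whose label is fixed by \<open>\<pi>\<close>, remain locally linear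
(\<open>card_locally_linear_single_twist\<close>). Their number \<open>q + 1 + 2qf\<close>, where \<open>f\<close> is the number of fixed points of
\<open>\<pi>\<close>, takes \<open>q - 1\<close> values, because \<open>f\<close> can be any of \<open>0, \<dots>, q - 2\<close>.

One more graph is obtained by altering two bijections that concern four different planes, both by a
permutation that fixes \<open>0\<close> and is not a translation. Then only the \<open>p\<^sub>i\<close> are locally linear, as for \<open>f = 0\<close>.
But the line of \<open>W(q)\<close> that carries the label \<open>0\<close> everywhere is still a clique of size \<open>q + 1\<close>, so that some
edge spans a line none of whose points is locally linear (\<open>double_twist_has_isolated_line\<close>), whereas for
\<open>f = 0\<close> every edge between different planes fails to span a line (\<open>single_twist_no_isolated_line\<close>).
\<close>

section \<open>Strongly regular graphs with equal parameters are cospectral\<close>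

definition mtrace :: "'a::comm_ring_1 mat \<Rightarrow> 'a" where
  "mtrace A = (\<Sum>i<dim_row A. A $$ (i, i))"

lemma mtrace_mult:
  assumes "A \<in> carrier_mat n n" "B \<in> carrier_mat n n"
  shows "mtrace (A * B) = (\<Sum>i<n. \<Sum>j<n. A $$ (i, j) * B $$ (j, i))"
  using assms by (auto simp: mtrace_def scalar_prod_def intro!: sum.cong) 

lemma mtrace_comm:
  assumes "A \<in> carrier_mat n n" "B \<in> carrier_mat n n"
  shows "mtrace (A * B) = mtrace (B * A)"
  unfolding mtrace_mult[OF assms] mtrace_mult[OF assms(2,1)]
  by (subst sum.swap) (simp add: mult.commute)

lemma mtrace_similar:
  assumes "similar_mat_wit A B P Q" "A \<in> carrier_mat n n"
  shows "mtrace A = mtrace B"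
proof -
  note w = similar_mat_witD2[OF assms(2,1)]
  have "mtrace A = mtrace (P * (B * Q))"
    using w by (simp add: assoc_mult_mat[of P n n B n Q n])
  also have "\<dots> = mtrace (B * Q * P)"
    using w by (intro mtrace_comm[where n = n]) auto
  also have "B * Q * P = B"
    using w by (simp add: assoc_mult_mat[of B n n Q n P n])
  finally show ?thesis .
qed

lemma similar_mat_wit_square:
  assumes "similar_mat_wit A B P Q" "A \<in> carrier_mat n n"
  shows "similar_mat_wit (A * A) (B * B) P Q"
proof -
  note w = similar_mat_witD2[OF assms(2,1)]
  have c: "A \<in> carrier_mat n n" "B \<in> carrier_mat n n" "P \<in> carrier_mat n n" "Q \<in> carrier_mat n n"
    using w by auto
  have "A * A = (P * B * Q) * (P * B * Q)" using w(3) by simp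
  also have "\<dots> = P * B * (Q * (P * (B * Q)))"
    using c by (simp add: assoc_mult_mat[where n\<^sub>1=n and n\<^sub>2=n and n\<^sub>3=n and n\<^sub>4=n])
  also have "Q * (P * (B * Q)) = (Q * P) * (B * Q)"
    using c by (simp add: assoc_mult_mat[where n\<^sub>1=n and n\<^sub>2=n and n\<^sub>3=n and n\<^sub>4=n])
  also have "\<dots> = B * Q" using c w(2) by simp
  also have "P * B * (B * Q) = P * (B * B) * Q"
    using c by (simp add: assoc_mult_mat[where n\<^sub>1=n and n\<^sub>2=n and n\<^sub>3=n and n\<^sub>4=n])
  finally show ?thesis
    using w c by (intro similar_mat_witI[where n = n]) auto
qed

text \<open>A Schur triangulation carries the roots of the characteristic polynomial on its diagonal, and squaring a
triangular matrix squares the diagonal; traces are invariant under similarity.\<close>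

lemma char_poly_roots_power_sums:
  fixes A :: "complex mat"
  assumes A: "A \<in> carrier_mat n n"
  obtains es where "char_poly A = (\<Prod>e\<leftarrow>es. [:- e, 1:])" "length es = n"
    "sum_list es = mtrace A" "(\<Sum>e\<leftarrow>es. e\<^sup>2) = mtrace (A * A)"
proof -
  obtain es where es: "char_poly A = (\<Prod>e\<leftarrow>es. [:- e, 1:])" "length es = n"
    using char_poly_factorized[OF A] by blast
  obtain B P Q where s: "schur_decomposition A es = (B, P, Q)"
    by (cases "schur_decomposition A es")
  have w: "similar_mat_wit A B P Q" and u: "upper_triangular B" and d: "diag_mat B = es"
    using schur_decomposition[OF A es(1) s] by auto
  have B: "B \<in> carrier_mat n n" using similar_mat_witD2[OF A w] by auto
  have ith: "B $$ (i, i) = es ! i" if "i < n" for i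
    using d B that by (auto simp: diag_mat_def)
  have "sum_list es = mtrace B"
    using B es(2) ith by (simp add: mtrace_def sum_list_sum_nth atLeast0LessThan)
  moreover have "(\<Sum>e\<leftarrow>es. e\<^sup>2) = mtrace (B * B)"
  proof -
    have "(\<Sum>j<n. B $$ (i, j) * B $$ (j, i)) = (es ! i)\<^sup>2" if i: "i < n" for i
    proof -
      have "(\<Sum>j<n. B $$ (i, j) * B $$ (j, i)) = (\<Sum>j\<in>{i}. B $$ (i, j) * B $$ (j, i))"
      proof (rule sum.mono_neutral_right)
        show "\<forall>j\<in>{..<n} - {i}. B $$ (i, j) * B $$ (j, i) = 0"
          using u B i by (auto simp: upper_triangular_def not_less_iff_gr_or_eq neq_iff)
      qed (use i in auto)
      then show ?thesis using ith[OF i] by (simp add: power2_eq_square)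
    qed
    then show ?thesis
      using es(2) by (simp add: mtrace_mult[OF B B] sum_list_sum_nth atLeast0LessThan)
  qed
  ultimately show ?thesis
    using that[OF es] mtrace_similar[OF w A] mtrace_similar[OF similar_mat_wit_square[OF w A] mult_carrier_mat[OF A A]]
    by simp
qed

lemma proots_linear_factors:
  "proots (\<Prod>e\<leftarrow>es. [:- e, 1:]) = mset (es :: 'a::field list)"
proof (induction es)
  case (Cons e es)
  have "(\<Prod>e\<leftarrow>es. [:- e, 1:]) \<noteq> 0" by (auto simp: prod_list_zero_iff)
  then show ?case using Cons by (simp add: proots_mult proots_linear_factor del: mult_pCons_left)
qed simp

text \<open>A Vandermonde argument: if \<open>v\<close> is one of the three values and \<open>u\<close>, \<open>w\<close> cover the others, then the
polynomial \<open>(x - u)(x - w)\<close> vanishes on all elements but \<open>v\<close>, so its sum over the multiset gives the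
multiplicity of \<open>v\<close> and depends only on the first three power sums.\<close>

lemma mset_eq_of_power_sums:
  fixes M N :: "'a::field_char_0 multiset"
  assumes sub: "set_mset M \<subseteq> {a, b, c}" "set_mset N \<subseteq> {a, b, c}"
    and eq: "size M = size N" "sum_mset M = sum_mset N"
      "(\<Sum>x\<in>#M. x\<^sup>2) = (\<Sum>x\<in>#N. x\<^sup>2)"
  shows "M = N"
proof (rule multiset_eqI)
  fix v
  have "\<exists>u w. u \<noteq> v \<and> w \<noteq> v \<and> {a, b, c} - {v} \<subseteq> {u, w}" if "v \<in> {a, b, c}"
  proof -
    define e where "e x = (if x = v then v + 1 else x)" for x
    have e: "e x \<noteq> v" "x = v \<or> e x = x" for x by (auto simp: e_def)
    from that consider "v = a" | "v = b" | "v = c" by auto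
    then show ?thesis
    proof cases
      case 1
      then show ?thesis using e[of b] e[of c] by (intro exI[of _ "e b"] exI[of _ "e c"]) auto
    next
      case 2
      then show ?thesis using e[of a] e[of c] by (intro exI[of _ "e a"] exI[of _ "e c"]) auto
    next
      case 3
      then show ?thesis using e[of a] e[of b] by (intro exI[of _ "e a"] exI[of _ "e b"]) auto
    qed
  qed
  then obtain u w where uw: "v \<in> {a, b, c} \<Longrightarrow> u \<noteq> v \<and> w \<noteq> v \<and> {a, b, c} - {v} \<subseteq> {u, w}"
    by metis
  have key: "of_nat (count K v) * ((v - u) * (v - w)) =
      (\<Sum>x\<in>#K. x\<^sup>2) - (u + w) * sum_mset K + of_nat (size K) * (u * w)"
    if "set_mset K \<subseteq> {a, b, c}" and v: "v \<in> {a, b, c}" for K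
    using that(1)
  proof (induction K)
    case (add x K)
    have "x = v \<or> x = u \<or> x = w" using add.prems uw[OF v] by auto
    then show ?case using add uw[OF v]
      by (auto simp: algebra_simps power2_eq_square)
  qed simp
  show "count M v = count N v"
  proof (cases "v \<in> {a, b, c}")
    case True
    then have "of_nat (count M v) * ((v - u) * (v - w)) = (of_nat (count N v) * ((v - u) * (v - w)) :: 'a)"
      unfolding key[OF sub(1) True] key[OF sub(2) True] using eq by simp
    then show ?thesis using uw[OF True] by auto
  next
    case False
    then show ?thesis using sub by (metis not_in_iff subsetD)
  qed
qed

lemma srg_pair_graph:
  assumes "srg n k l m G"
  shows "finite (pverts G)" "(x, x) \<notin> parcs G" "(x, y) \<in> parcs G \<longleftrightarrow> (y, x) \<in> parcs G"
    "(x, y) \<in> parcs G \<Longrightarrow> x \<in> pverts G \<and> y \<in> pverts G"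
proof -
  interpret pair_graph G using assms by (simp add: srg_def)
  show "finite (pverts G)" by (rule pair_finite_verts)
  show "(x, x) \<notin> parcs G" using pair_no_loops by force
  show "(x, y) \<in> parcs G \<longleftrightarrow> (y, x) \<in> parcs G"
    using pair_sym_arcs by (auto simp: symmetric_def sym_def)
  show "(x, y) \<in> parcs G \<Longrightarrow> x \<in> pverts G \<and> y \<in> pverts G"
    by (auto dest: in_arcsD1 in_arcsD2)
qed

lemma sum_over_enumeration:
  assumes "distinct vs"
  shows "(\<Sum>i<length vs. f (vs ! i)) = sum f (set vs)"
  using assms by (simp add: sum.distinct_set_conv_list sum_list_sum_nth atLeast0LessThan)

lemma srg_walks_of_length_two:
  fixes a :: "'v \<Rightarrow> 'v \<Rightarrow> complex"
  assumes G: "srg n k l m G"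
  defines "a \<equiv> \<lambda>x y. if (x, y) \<in> parcs G then 1 else 0"
  assumes x: "x \<in> pverts G" and z: "z \<in> pverts G"
  shows "(\<Sum>y\<in>pverts G. a x y * a y z) =
    of_nat m + (of_nat l - of_nat m) * a x z + (if x = z then of_nat k - of_nat m else 0)"
proof -
  note p = srg_pair_graph[OF G]
  have "(\<Sum>y\<in>pverts G. a x y * a y z) =
      (\<Sum>y\<in>pverts G. if y \<in> parcs G `` {x} \<inter> parcs G `` {z} then 1 else 0)"
    by (intro sum.cong) (auto simp: a_def p(3))
  also have "\<dots> = of_nat (card (pverts G \<inter> (parcs G `` {x} \<inter> parcs G `` {z})))"
    by (subst sum.inter_restrict[symmetric]) (simp_all add: p(1))
  also have "pverts G \<inter> (parcs G `` {x} \<inter> parcs G `` {z}) = parcs G `` {x} \<inter> parcs G `` {z}"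
    using p(4) by auto
  finally show ?thesis
    using G x z p(2) by (auto simp: srg_def a_def)
qed

text \<open>Summing the eigenvalue equation over all vertices gives \<open>(e - k) s = 0\<close> for the sum \<open>s\<close> of the entries of an
eigenvector. If \<open>s = 0\<close>, then the all-ones part of the square of the adjacency matrix annihilates the
eigenvector and the quadratic equation remains.\<close>

lemma srg_eigenvalue:
  assumes G: "srg n k l m G" and vs: "distinct vs" "set vs = pverts G"
    and e: "eigenvalue (adjacency_mat vs G) e"
  shows "(e - of_nat k) * (e\<^sup>2 - (of_nat l - of_nat m) * e - (of_nat k - of_nat m)) = 0"
proof -
  define a where "a x y = (if (x, y) \<in> parcs G then 1 else 0 :: complex)" for x y
  note p = srg_pair_graph[OF G]
  let ?n = "length vs"
  obtain v where v: "v \<in> carrier_vec ?n" "v \<noteq> 0\<^sub>v ?n" "adjacency_mat vs G *\<^sub>v v = e \<cdot>\<^sub>v v"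
    using e by (auto simp: eigenvalue_def eigenvector_def adjacency_mat_def)
  define w where "w x = vec_index v (THE i. i < ?n \<and> vs ! i = x)" for x
  have w: "w (vs ! i) = vec_index v i" if "i < ?n" for i
  proof -
    have "(THE j. j < ?n \<and> vs ! j = vs ! i) = i"
      using that vs(1) by (auto simp: nth_eq_iff_index_eq)
    then show ?thesis by (simp add: w_def)
  qed
  have eig: "(\<Sum>y\<in>pverts G. a x y * w y) = e * w x" if x: "x \<in> pverts G" for x
  proof -
    obtain i where i: "i < ?n" "x = vs ! i" using x vs(2) by (metis in_set_conv_nth)
    have "(\<Sum>y\<in>pverts G. a x y * w y) = (\<Sum>j<?n. a (vs ! i) (vs ! j) * w (vs ! j))"
      using sum_over_enumeration[OF vs(1), of "\<lambda>y. a x y * w y"] vs(2) i by simp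
    also have "\<dots> = vec_index (adjacency_mat vs G *\<^sub>v v) i"
      using i v(1) w by (auto simp: adjacency_mat_def scalar_prod_def a_def atLeast0LessThan intro!: sum.cong)
    also have "\<dots> = e * w x" using i v(1,3) w by simp
    finally show ?thesis .
  qed
  define s where "s = (\<Sum>x\<in>pverts G. w x)"
  have deg: "(\<Sum>x\<in>pverts G. a x y) = of_nat k" if "y \<in> pverts G" for y
  proof -
    have "(\<Sum>x\<in>pverts G. a x y) = (\<Sum>x\<in>pverts G. if x \<in> parcs G `` {y} then 1 else 0)"
      by (intro sum.cong) (auto simp: a_def p(3))
    also have "\<dots> = of_nat (card (pverts G \<inter> parcs G `` {y}))"
      by (subst sum.inter_restrict[symmetric]) (simp_all add: p(1))
    also have "pverts G \<inter> parcs G `` {y} = parcs G `` {y}" using p(4) by auto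
    finally show ?thesis using G that by (simp add: srg_def)
  qed
  have "e * s = (\<Sum>x\<in>pverts G. \<Sum>y\<in>pverts G. a x y * w y)"
    by (simp add: s_def sum_distrib_left eig)
  also have "\<dots> = (\<Sum>y\<in>pverts G. (\<Sum>x\<in>pverts G. a x y) * w y)"
    by (subst sum.swap) (simp add: sum_distrib_right)
  also have "\<dots> = of_nat k * s" by (simp add: s_def sum_distrib_left deg)
  finally have es: "e * s = of_nat k * s" .
  show ?thesis
  proof (cases "s = 0")
    case False
    then show ?thesis using es by simp
  next
    case True
    obtain i where i: "i < ?n" "vec_index v i \<noteq> 0" using v(1,2) by (metis carrier_vecD eq_vecI index_zero_vec)
    define x where "x = vs ! i"
    have x: "x \<in> pverts G" "w x \<noteq> 0" using i vs(2) w by (auto simp: x_def)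
    have "e\<^sup>2 * w x = e * (\<Sum>y\<in>pverts G. a x y * w y)" by (simp add: eig[OF x(1)] power2_eq_square)
    also have "\<dots> = (\<Sum>y\<in>pverts G. a x y * (e * w y))"
      by (simp add: sum_distrib_left mult_ac)
    also have "\<dots> = (\<Sum>y\<in>pverts G. a x y * (\<Sum>z\<in>pverts G. a y z * w z))"
      by (simp add: eig)
    also have "\<dots> = (\<Sum>z\<in>pverts G. (\<Sum>y\<in>pverts G. a x y * a y z) * w z)"
      by (simp add: sum_distrib_left sum_distrib_right mult_ac) (subst sum.swap, simp)
    also have "\<dots> = (\<Sum>z\<in>pverts G. of_nat m * w z + (of_nat l - of_nat m) * (a x z * w z)
        + (if x = z then (of_nat k - of_nat m) * w z else 0))"
    proof (intro sum.cong refl)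
      fix z assume z: "z \<in> pverts G"
      show "(\<Sum>y\<in>pverts G. a x y * a y z) * w z = of_nat m * w z
          + (of_nat l - of_nat m) * (a x z * w z) + (if x = z then (of_nat k - of_nat m) * w z else 0)"
        unfolding srg_walks_of_length_two[OF G x(1) z, folded a_def] by (simp add: algebra_simps)
    qed
    also have "\<dots> = of_nat m * s + (of_nat l - of_nat m) * (e * w x) + (of_nat k - of_nat m) * w x"
      using p(1) x(1) by (simp add: sum.distrib sum_distrib_left[symmetric] s_def eig)
    finally have "(e\<^sup>2 - (of_nat l - of_nat m) * e - (of_nat k - of_nat m)) * w x = 0"
      using True by (simp add: algebra_simps)
    then show ?thesis using x(2) by simp
  qed
qed

lemma srg_adjacency_traces:
  assumes G: "srg n k l m G" and vs: "distinct vs" "set vs = pverts G"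
  shows "mtrace (adjacency_mat vs G) = 0"
    and "mtrace (adjacency_mat vs G * adjacency_mat vs G) = of_nat (n * k)"
proof -
  note p = srg_pair_graph[OF G]
  let ?A = "adjacency_mat vs G"
  have A: "?A \<in> carrier_mat (length vs) (length vs)" by (simp add: adjacency_mat_def)
  show "mtrace ?A = 0" using p(2) by (simp add: mtrace_def adjacency_mat_def)
  define a where "a x y = (if (x, y) \<in> parcs G then 1 else 0 :: complex)" for x y
  have "mtrace (?A * ?A) = (\<Sum>i<length vs. \<Sum>j<length vs. a (vs ! i) (vs ! j) * a (vs ! j) (vs ! i))"
    unfolding mtrace_mult[OF A A] by (intro sum.cong) (auto simp: adjacency_mat_def a_def)
  also have "\<dots> = (\<Sum>x\<in>pverts G. \<Sum>y\<in>pverts G. a x y * a y x)"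
    unfolding sum_over_enumeration[OF vs(1), of "\<lambda>x. \<Sum>j<length vs. a x (vs ! j) * a (vs ! j) x"] vs(2)
    by (rule sum.cong[OF refl],
        rule sum_over_enumeration[OF vs(1), of "\<lambda>y. a _ y * a y _", unfolded vs(2)])
  also have "\<dots> = of_nat (n * k)"
  proof -
    have "(\<Sum>y\<in>pverts G. a x y * a y x) = of_nat k" if "x \<in> pverts G" for x
      using srg_walks_of_length_two[OF G that that] p(2)[of x] unfolding a_def by simp
    then show ?thesis using G by (simp add: srg_def)
  qed
  finally show "mtrace (?A * ?A) = of_nat (n * k)" .
qed

text \<open>All eigenvalues lie among \<open>k\<close> and the two roots of a quadratic polynomial in the parameters. Their number is
\<open>n\<close>, their sum is the trace \<open>0\<close> and their sum of squares is the number \<open>nk\<close> of arcs, which leaves only one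
possible multiset.\<close>

theorem srg_same_parameters_cospectral:
  assumes G: "srg n k l m G" and H: "srg n k l m H"
  shows "cospectral G H"
proof -
  define u where "u = (of_nat l - of_nat m :: complex)"
  define v where "v = (of_nat k - of_nat m :: complex)"
  define d where "d = csqrt (u\<^sup>2 + 4 * v)"
  define r where "r = (u + d) / 2"
  define s where "s = (u - d) / 2"
  \<comment> \<open>The roots are \<open>r\<close> and \<open>s\<close> by Vieta's formulas.\<close>
  have us: "u = r + s" by (simp add: r_def s_def flip: add_divide_distrib)
  have "r * s = (u\<^sup>2 - d\<^sup>2) / 4"
    by (simp add: r_def s_def algebra_simps power2_eq_square)
  then have vp: "v = - (r * s)" by (simp add: d_def)
  have factor: "x\<^sup>2 - u * x - v = (x - r) * (x - s)" for x
    unfolding us vp by (simp add: algebra_simps power2_eq_square)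
  have *: "set_mset (adjacency_spectrum F) \<subseteq> {of_nat k, r, s} \<and> size (adjacency_spectrum F) = n \<and>
      sum_mset (adjacency_spectrum F) = 0 \<and> (\<Sum>x\<in>#adjacency_spectrum F. x\<^sup>2) = of_nat (n * k)"
    if F: "srg n k l m F" for F :: "'x pair_pre_digraph"
  proof -
    define vs where "vs = (SOME vs. distinct vs \<and> set vs = pverts F)"
    have vs: "distinct vs" "set vs = pverts F"
      using someI_ex[of "\<lambda>vs. distinct vs \<and> set vs = pverts F"]
        finite_distinct_list[OF srg_pair_graph(1)[OF F]] by (auto simp: vs_def)
    have len: "length vs = n" using distinct_card[OF vs(1)] vs(2) F by (simp add: srg_def)
    let ?A = "adjacency_mat vs F"
    have A: "?A \<in> carrier_mat n n" using len by (simp add: adjacency_mat_def)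
    obtain es where es: "char_poly ?A = (\<Prod>e\<leftarrow>es. [:- e, 1:])" "length es = n"
      "sum_list es = mtrace ?A" "(\<Sum>e\<leftarrow>es. e\<^sup>2) = mtrace (?A * ?A)"
      using char_poly_roots_power_sums[OF A] by blast
    have spec: "adjacency_spectrum F = mset es"
      by (simp add: adjacency_spectrum_def vs_def[symmetric] es(1) proots_linear_factors)
    have "e \<in> {of_nat k, r, s}" if "e \<in> set es" for e
    proof -
      have "poly (char_poly ?A) e = 0" using that unfolding es(1) poly_prod_list
        by (force simp: prod_list_zero_iff)
      then have "eigenvalue ?A e" using eigenvalue_root_char_poly[OF A] by simp
      from srg_eigenvalue[OF F vs this] show ?thesis
        unfolding u_def[symmetric] v_def[symmetric] factor by auto
    qed
    then show ?thesis
      using es(2-4) srg_adjacency_traces[OF F vs]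
      by (auto simp: spec sum_mset_sum_list simp flip: mset_map)
  qed
  show ?thesis
    unfolding cospectral_def using *[OF G] *[OF H] by (intro mset_eq_of_power_sums) auto
qed

section \<open>Strongly regular graphs from polarities without non-absolute points\<close>

text \<open>The relation is meant to be reflexive, like orthogonality of points; the graph forgets the loops. Counting
with loops has the advantage that adjacent and non-adjacent pairs need not be distinguished.\<close>

definition polarity_graph :: "'v set \<Rightarrow> ('v \<Rightarrow> 'v \<Rightarrow> bool) \<Rightarrow> 'v pair_pre_digraph" where
  "polarity_graph V R = \<lparr> pverts = V, parcs = {(x, y). x \<in> V \<and> y \<in> V \<and> x \<noteq> y \<and> R x y} \<rparr>"

lemma polarity_graph_simps [simp]:
  "pverts (polarity_graph V R) = V"
  "(x, y) \<in> parcs (polarity_graph V R) \<longleftrightarrow> x \<in> V \<and> y \<in> V \<and> x \<noteq> y \<and> R x y"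
  by (simp_all add: polarity_graph_def)

lemma pair_graph_polarity_graph:
  assumes "finite V" and "\<And>x y. R x y \<Longrightarrow> R y x"
  shows "pair_graph (polarity_graph V R)"
proof
  have "parcs (polarity_graph V R) \<subseteq> V \<times> V" by (auto simp: polarity_graph_def)
  then show "finite (parcs (polarity_graph V R))" using assms(1) finite_subset by blast
  show "symmetric (polarity_graph V R)"
    using assms(2) by (auto simp: symmetric_def sym_def)
qed (use assms in \<open>auto simp: polarity_graph_def\<close>)

text \<open>With loops, both end points of an edge are common neighbours of the two; this is where \<open>m - 2\<close> comes from.\<close>

lemma srg_polarity_graph:
  assumes fin: "finite V" and refl: "\<And>x. x \<in> V \<Longrightarrow> R x x" and sym: "\<And>x y. R x y \<Longrightarrow> R y x"
    and k: "\<And>x. x \<in> V \<Longrightarrow> card {z \<in> V. R x z} = Suc k" "0 < k" "k < card V - 1"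
    and m: "\<And>x y. x \<in> V \<Longrightarrow> y \<in> V \<Longrightarrow> x \<noteq> y \<Longrightarrow> card {z \<in> V. R x z \<and> R y z} = m"
  shows "srg (card V) k (m - 2) m (polarity_graph V R)"
  unfolding srg_def
proof (intro conjI ballI impI)
  let ?E = "parcs (polarity_graph V R)"
  show "pair_graph (polarity_graph V R)" using fin sym by (rule pair_graph_polarity_graph)
  fix x assume x: "x \<in> pverts (polarity_graph V R)"
  have "?E `` {x} = {z \<in> V. R x z} - {x}" using x by auto
  then show "card (?E `` {x}) = k" using k(1)[of x] x refl fin by simp
  fix y assume y: "y \<in> pverts (polarity_graph V R)" and ne: "x \<noteq> y"
  have eq: "?E `` {x} \<inter> ?E `` {y} = {z \<in> V. R x z \<and> R y z} - {x, y}" using x y by auto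
  show "card (?E `` {x} \<inter> ?E `` {y}) = (if (x, y) \<in> ?E then m - 2 else m)"
  proof (cases "R x y")
    case True
    then have "{x, y} \<subseteq> {z \<in> V. R x z \<and> R y z}" using x y refl sym by auto
    then show ?thesis using True x y ne m[of x y] by (simp add: eq card_Diff_subset)
  next
    case False
    then have "{z \<in> V. R x z \<and> R y z} - {x, y} = {z \<in> V. R x z \<and> R y z}" using sym by auto
    then show ?thesis using False x y ne m[of x y] by (simp add: eq)
  qed
qed (use k in auto)

lemma card_bij_Collect:
  assumes "bij_betw \<phi> V UNIV"
  shows "card {z \<in> V. P (\<phi> z)} = card {z. P z}"
proof -
  have "bij_betw \<phi> {z \<in> V. P (\<phi> z)} {z. P z}"
    using assms unfolding bij_betw_def
    by (auto intro: inj_on_subset)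
  then show ?thesis by (rule bij_betw_same_card)
qed

lemma srg_polarity_graph_pullback:
  fixes R :: "'w::finite \<Rightarrow> 'w \<Rightarrow> bool"
  assumes \<phi>: "bij_betw \<phi> V UNIV" and refl: "\<And>x. R x x" and sym: "\<And>x y. R x y \<Longrightarrow> R y x"
    and k: "\<And>x. card {z. R x z} = Suc k" "0 < k" "k < CARD('w) - 1"
    and m: "\<And>x y. x \<noteq> y \<Longrightarrow> card {z. R x z \<and> R y z} = m"
  shows "srg (CARD('w)) k (m - 2) m (polarity_graph V (\<lambda>x y. R (\<phi> x) (\<phi> y)))"
proof -
  have "card V = CARD('w)" using \<phi> by (rule bij_betw_same_card)
  moreover have "srg (card V) k (m - 2) m (polarity_graph V (\<lambda>x y. R (\<phi> x) (\<phi> y)))"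
  proof (rule srg_polarity_graph)
    show "finite V" using bij_betw_finite[OF \<phi>] by simp
    show "R (\<phi> x) (\<phi> x)" for x by (rule refl)
    show "R (\<phi> y) (\<phi> x)" if "R (\<phi> x) (\<phi> y)" for x y using that by (rule sym)
    show "0 < k" "k < card V - 1" using k(2,3) \<open>card V = CARD('w)\<close> by simp_all
    show "card {z \<in> V. R (\<phi> x) (\<phi> z)} = Suc k" for x
      using card_bij_Collect[OF \<phi>, of "R (\<phi> x)"] k(1)[of "\<phi> x"] by simp
    show "card {z \<in> V. R (\<phi> x) (\<phi> z) \<and> R (\<phi> y) (\<phi> z)} = m"
      if "x \<in> V" "y \<in> V" "x \<noteq> y" for x y
    proof -
      have "\<phi> x \<noteq> \<phi> y" using \<phi> that by (metis bij_betw_imp_inj_on inj_on_eq_iff)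
      then show ?thesis
        using card_bij_Collect[OF \<phi>, of "\<lambda>z. R (\<phi> x) z \<and> R (\<phi> y) z"] m[of "\<phi> x" "\<phi> y"] by simp
    qed
  qed
  ultimately show ?thesis by simp
qed

lemma isomorphic_graphsD:
  assumes "isomorphic_graphs G H"
  obtains h where "bij_betw h (pverts G) (pverts H)"
    "\<And>x y. x \<in> pverts G \<Longrightarrow> y \<in> pverts G \<Longrightarrow> (x, y) \<in> parcs G \<longleftrightarrow> (h x, h y) \<in> parcs H"
proof -
  obtain f where f: "pre_digraph.digraph_isomorphism (with_proj G) f" "with_proj H = app_iso f (with_proj G)"
    using assms by (auto simp: digraph_iso_def)
  let ?h = "iso_verts f"
  have inj: "inj_on ?h (pverts G)" and wf: "wf_digraph (with_proj G)"
    using f(1) by (auto simp: pre_digraph.digraph_isomorphism_def)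
  have H: "pverts H = ?h ` pverts G" "parcs H = iso_arcs f ` parcs G" "iso_tail f = fst" "iso_head f = snd"
    using f(2) by (auto simp: app_iso_def with_proj_def)
  have arc: "iso_arcs f (x, y) = (?h x, ?h y)" if "(x, y) \<in> parcs G" for x y
    using f(1) that H(3,4) by (auto simp: pre_digraph.digraph_isomorphism_def prod_eq_iff)
  have "(x, y) \<in> parcs G \<longleftrightarrow> (?h x, ?h y) \<in> parcs H" if "x \<in> pverts G" "y \<in> pverts G" for x y
  proof
    show "(x, y) \<in> parcs G \<Longrightarrow> (?h x, ?h y) \<in> parcs H" using arc H(2) by force
  next
    assume "(?h x, ?h y) \<in> parcs H"
    then obtain u v where uv: "(u, v) \<in> parcs G" "(?h x, ?h y) = iso_arcs f (u, v)"
      using H(2) by auto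
    then have "u \<in> pverts G" "v \<in> pverts G" using wf by (auto dest: wf_digraph.wellformed)
    then show "(x, y) \<in> parcs G"
      using uv arc[OF uv(1)] inj that by (auto dest: inj_onD)
  qed
  with inj H(1) show ?thesis by (intro that[of ?h]) (auto simp: bij_betw_def)
qed

text \<open>Both graphs live on the same set \<open>V\<close>, but are pulled back from relations on a whole type. Conjugating an
isomorphism by the labelling \<open>\<phi>\<close> moves it there, so that invariants can be computed on the type.\<close>

lemma isomorphic_polarity_graphsD:
  fixes R R' :: "'w \<Rightarrow> 'w \<Rightarrow> bool"
  assumes \<phi>: "bij_betw \<phi> V UNIV" and refl: "\<And>x. R x x" "\<And>x. R' x x"
    and iso: "isomorphic_graphs (polarity_graph V (\<lambda>x y. R (\<phi> x) (\<phi> y)))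
                (polarity_graph V (\<lambda>x y. R' (\<phi> x) (\<phi> y)))"
  obtains \<psi> where "bij \<psi>" "\<And>x y. R x y \<longleftrightarrow> R' (\<psi> x) (\<psi> y)"
proof -
  obtain h where h: "bij_betw h V V" and
    e: "\<And>x y. x \<in> V \<Longrightarrow> y \<in> V \<Longrightarrow> (x \<noteq> y \<and> R (\<phi> x) (\<phi> y)) \<longleftrightarrow>
          (h x \<in> V \<and> h y \<in> V \<and> h x \<noteq> h y \<and> R' (\<phi> (h x)) (\<phi> (h y)))"
    using isomorphic_graphsD[OF iso] by (metis polarity_graph_simps)
  define \<theta> where "\<theta> = inv_into V \<phi>"
  have \<theta>: "bij_betw \<theta> UNIV V" "\<And>w. \<phi> (\<theta> w) = w"
    using \<phi> by (auto simp: \<theta>_def bij_betw_inv_into bij_betw_inv_into_right)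
  define \<psi> where "\<psi> = \<phi> \<circ> h \<circ> \<theta>"
  have "bij \<psi>" unfolding \<psi>_def using \<phi> h \<theta>(1) by (metis bij_betw_trans)
  moreover have "R x y \<longleftrightarrow> R' (\<psi> x) (\<psi> y)" for x y
  proof (cases "x = y")
    case False
    have V: "\<theta> x \<in> V" "\<theta> y \<in> V" using \<theta>(1) by (auto simp: bij_betw_def)
    then have "h (\<theta> x) \<in> V" "h (\<theta> y) \<in> V" using h by (auto simp: bij_betw_def)
    moreover have "\<theta> x \<noteq> \<theta> y" using False \<theta>(2) by metis
    moreover from this have "h (\<theta> x) \<noteq> h (\<theta> y)"
      using h V by (metis bij_betw_imp_inj_on inj_on_eq_iff)
    ultimately show ?thesis using e[OF V] by (simp add: \<psi>_def \<theta>(2))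
  qed (simp add: refl)
  ultimately show ?thesis by (rule that)
qed

section \<open>Invariants: edges whose common neighbourhood is a clique\<close>

text \<open>For a reflexive relation \<open>z\<close> and \<open>w\<close> may also be \<open>x\<close> or \<open>y\<close>. In a generalized quadrangle every edge has
this property, the clique being the line through \<open>x\<close> and \<open>y\<close>.\<close>

definition spans_line :: "('v \<Rightarrow> 'v \<Rightarrow> bool) \<Rightarrow> 'v \<Rightarrow> 'v \<Rightarrow> bool" where
  "spans_line R x y \<longleftrightarrow> (\<forall>z w. R x z \<and> R y z \<and> R x w \<and> R y w \<longrightarrow> R z w)"

definition locally_linear :: "('v \<Rightarrow> 'v \<Rightarrow> bool) \<Rightarrow> 'v \<Rightarrow> bool" where
  "locally_linear R x \<longleftrightarrow> (\<forall>y. R x y \<and> y \<noteq> x \<longrightarrow> spans_line R x y)"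

text \<open>Here \<open>z\<close> runs over all points of the spanned line, including \<open>x\<close> and \<open>y\<close>.\<close>

definition has_isolated_line :: "('v \<Rightarrow> 'v \<Rightarrow> bool) \<Rightarrow> bool" where
  "has_isolated_line R \<longleftrightarrow>
     (\<exists>x y. x \<noteq> y \<and> R x y \<and> spans_line R x y \<and> (\<forall>z. R x z \<and> R y z \<longrightarrow> \<not> locally_linear R z))"

lemma
  assumes \<psi>: "bij \<psi>" and iso: "\<And>x y. R x y \<longleftrightarrow> R' (\<psi> x) (\<psi> y)"
  shows card_locally_linear_iso: "card {x. locally_linear R x} = card {x. locally_linear R' x}"
    and has_isolated_line_iso: "has_isolated_line R \<longleftrightarrow> has_isolated_line R'"
proof -
  have all: "(\<forall>x. P (\<psi> x)) \<longleftrightarrow> (\<forall>x. P x)" for P using \<psi> by (metis bij_pointE)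
  have all2: "(\<forall>x y. P (\<psi> x) (\<psi> y)) \<longleftrightarrow> (\<forall>x y. P x y)" for P using \<psi> by (metis bij_pointE)
  have ex2: "(\<exists>x y. P (\<psi> x) (\<psi> y)) \<longleftrightarrow> (\<exists>x y. P x y)" for P using \<psi> by (metis bij_pointE)
  have inj: "\<psi> x = \<psi> y \<longleftrightarrow> x = y" for x y using \<psi> by (metis bij_pointE)
  have spans: "spans_line R x y \<longleftrightarrow> spans_line R' (\<psi> x) (\<psi> y)" for x y
    unfolding spans_line_def iso
    by (rule all2[where P = "\<lambda>z w. R' (\<psi> x) z \<and> R' (\<psi> y) z \<and> R' (\<psi> x) w \<and> R' (\<psi> y) w \<longrightarrow> R' z w"])
  have "locally_linear R x \<longleftrightarrow>
      (\<forall>y. R' (\<psi> x) (\<psi> y) \<and> \<psi> y \<noteq> \<psi> x \<longrightarrow> spans_line R' (\<psi> x) (\<psi> y))" for x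
    by (simp add: locally_linear_def iso spans inj)
  moreover have "(\<forall>y. R' (\<psi> x) (\<psi> y) \<and> \<psi> y \<noteq> \<psi> x \<longrightarrow> spans_line R' (\<psi> x) (\<psi> y)) \<longleftrightarrow>
      locally_linear R' (\<psi> x)" for x
    unfolding locally_linear_def
    by (rule all[where P = "\<lambda>y. R' (\<psi> x) y \<and> y \<noteq> \<psi> x \<longrightarrow> spans_line R' (\<psi> x) y"])
  ultimately have loc: "locally_linear R x \<longleftrightarrow> locally_linear R' (\<psi> x)" for x by simp
  show "card {x. locally_linear R x} = card {x. locally_linear R' x}"
    using card_bij_Collect[OF \<psi>, of "locally_linear R'"] by (simp add: loc)
  show "has_isolated_line R \<longleftrightarrow> has_isolated_line R'"
  proof -
    have line: "(\<forall>z. R x z \<and> R y z \<longrightarrow> \<not> locally_linear R z) \<longleftrightarrow>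
        (\<forall>z. R' (\<psi> x) z \<and> R' (\<psi> y) z \<longrightarrow> \<not> locally_linear R' z)" for x y
      unfolding iso loc
      by (rule all[where P = "\<lambda>z. R' (\<psi> x) z \<and> R' (\<psi> y) z \<longrightarrow> \<not> locally_linear R' z"])
    have "has_isolated_line R \<longleftrightarrow> (\<exists>x y. \<psi> x \<noteq> \<psi> y \<and> R' (\<psi> x) (\<psi> y) \<and> spans_line R' (\<psi> x) (\<psi> y) \<and>
        (\<forall>z. R' (\<psi> x) z \<and> R' (\<psi> y) z \<longrightarrow> \<not> locally_linear R' z))"
      unfolding has_isolated_line_def line unfolding iso spans inj ..
    then show ?thesis
      unfolding has_isolated_line_def[of R'] ex2[where P = "\<lambda>x y. x \<noteq> y \<and> R' x y \<and> spans_line R' x y \<and>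
        (\<forall>z. R' x z \<and> R' y z \<longrightarrow> \<not> locally_linear R' z)"] .
  qed
qed

section \<open>Geometric graphs with the parameters of a generalized quadrangle of order (q,q)\<close>

text \<open>In a partial geometry the valency is \<open>s(t + 1)\<close>, non-adjacent points have \<open>\<alpha>(t + 1)\<close> common neighbours and
adjacent points at least \<open>s - 1\<close>. The last fact gives \<open>s \<le> q\<close>, the first \<open>t \<ge> q\<close>, and then
\<open>\<alpha>(t + 1) = q + 1\<close> leaves \<open>\<alpha> = 1\<close>.\<close>

lemma partial_geometry_parameters:
  assumes pg: "partial_geometry s t \<alpha> V L" and G: "srg n (q * (q + 1)) (q - 1) (q + 1) (collinearity_graph V L)"
    and q: "q \<ge> 1"
  shows "\<alpha> = 1"
proof -
  note p = srg_pair_graph[OF G]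
  let ?E = "parcs (collinearity_graph V L)"
  have E: "(x, y) \<in> ?E \<longleftrightarrow> x \<in> V \<and> y \<in> V \<and> x \<noteq> y \<and> (\<exists>l\<in>L. x \<in> l \<and> y \<in> l)" for x y
    by (auto simp: collinearity_graph_def collinear_points_def)
  have V: "pverts (collinearity_graph V L) = V" by (simp add: collinearity_graph_def)
  have finV: "finite V" using p(1) V by simp
  have lines: "l \<subseteq> V" "card l = s + 1" if "l \<in> L" for l
    using pg that by (auto simp: partial_geometry_def partial_linear_space_def)
  have inV: "u \<in> V" if "l \<in> L" "u \<in> l" for l u using lines(1) that by blast
  have finl: "finite l" if "l \<in> L" for l using lines(1)[OF that] finV finite_subset by blast
  have "\<forall>x\<in>V. \<forall>y\<in>V. x \<noteq> y \<longrightarrow> (\<forall>l\<in>L. \<forall>m\<in>L. x \<in> l \<and> y \<in> l \<and> x \<in> m \<and> y \<in> m \<longrightarrow> l = m)"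
    using pg by (simp add: partial_geometry_def partial_linear_space_def)
  then have uniq: "l = l'"
    if "l \<in> L" "l' \<in> L" "x \<noteq> y" "x \<in> l" "y \<in> l" "x \<in> l'" "y \<in> l'" for l l' x y
    using that lines(1) by (metis subsetD)
  have thr: "card {l \<in> L. x \<in> l} = t + 1" if "x \<in> V" for x
    using pg that by (auto simp: partial_geometry_def)
  have alpha: "\<alpha> \<ge> 1" "\<And>x l. x \<in> V \<Longrightarrow> l \<in> L \<Longrightarrow> x \<notin> l \<Longrightarrow> card {y \<in> l. collinear_points L x y} = \<alpha>"
    using pg by (auto simp: partial_geometry_def)
  have finL: "finite {l \<in> L. x \<in> l}" if "x \<in> V" for x
    by (rule card_ge_0_finite) (simp add: thr[OF that])
  have deg: "card (?E `` {x}) = q * (q + 1)" if "x \<in> V" for x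
    using G that V by (simp add: srg_def)
  have "V \<noteq> {}" using G V by (auto simp: srg_def)
  then obtain x where x: "x \<in> V" by blast
  have "{l \<in> L. x \<in> l} \<noteq> {}" using thr[OF x] by force
  then obtain l where l: "l \<in> L" "x \<in> l" by blast
  have "\<forall>l\<in>L. \<exists>x\<in>l. \<exists>y\<in>l. x \<noteq> y"
    using pg by (simp add: partial_geometry_def partial_linear_space_def)
  then obtain y where y: "y \<in> l" "x \<noteq> y" using l by metis
  \<comment> \<open>the remaining points of a line are common neighbours of two of its points, so \<open>s \<le> q\<close>\<close>
  have xyE: "(x, y) \<in> ?E" using x y l lines(1)[OF l(1)] E by blast
  then have "card (?E `` {x} \<inter> ?E `` {y}) = q - 1"
    using G V p(4)[OF xyE] y(2) by (simp add: srg_def)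
  moreover have "l - {x, y} \<subseteq> ?E `` {x} \<inter> ?E `` {y}"
    using l y lines(1)[OF l(1)] E by blast
  moreover have "finite (?E `` {x} \<inter> ?E `` {y})"
    by (rule finite_subset[OF _ finV]) (use E in blast)
  ultimately have "card (l - {x, y}) \<le> q - 1" using card_mono by metis
  moreover have "card (l - {x, y}) = s - 1"
    using l y lines(2)[OF l(1)] finl[OF l(1)] by (subst card_Diff_subset) auto
  ultimately have sq: "s \<le> q" using q by linarith
  \<comment> \<open>hence at least \<open>q + 1\<close> lines are needed to reach the valency\<close>
  have "?E `` {x} = (\<Union>l\<in>{l \<in> L. x \<in> l}. l - {x})"
    using x by (auto simp: E intro: inV)
  then have "q * (q + 1) \<le> (\<Sum>l\<in>{l \<in> L. x \<in> l}. card (l - {x}))"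
    using deg[OF x] card_UN_le[OF finL[OF x], of "\<lambda>l. l - {x}"] by simp
  also have "\<dots> = (\<Sum>l\<in>{l \<in> L. x \<in> l}. s)"
    using lines(2) finl by (intro sum.cong) auto
  also have "\<dots> = (t + 1) * s" using thr[OF x] by simp
  also have "\<dots> \<le> (t + 1) * q" by (rule mult_le_mono2[OF sq])
  finally have "q * (q + 1) \<le> q * (t + 1)" by (simp only: mult.commute)
  then have tq: "q + 1 \<le> t + 1" using q by simp
  \<comment> \<open>a non-neighbour shares \<open>\<alpha>\<close> neighbours with \<open>x\<close> on each of them\<close>
  have "card (insert x (?E `` {x})) < card V"
  proof -
    have "card (insert x (?E `` {x})) \<le> Suc (card (?E `` {x}))" 
      by (cases "finite (?E `` {x})") (simp_all add: card_insert_if)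
    then show ?thesis using deg[OF x] G V by (auto simp: srg_def)
  qed
  then obtain z where z: "z \<in> V" "z \<noteq> x" "(x, z) \<notin> ?E"
  proof -
    have "finite (insert x (?E `` {x}))"
      by (rule finite_subset[OF _ finV]) (use x E in auto)
    with \<open>card (insert x (?E `` {x})) < card V\<close> have "\<not> V \<subseteq> insert x (?E `` {x})"
      using card_mono by (metis linorder_not_le)
    then show ?thesis using that by blast
  qed
  have nl: "z \<notin> l" if "l \<in> L" "x \<in> l" for l using z x that by (auto simp: E)
  have "card (\<Union>l\<in>{l \<in> L. x \<in> l}. {y \<in> l. collinear_points L z y}) =
      (\<Sum>l\<in>{l \<in> L. x \<in> l}. card {y \<in> l. collinear_points L z y})"
  proof (rule card_UN_disjoint[OF finL[OF x]])
    show "\<forall>i\<in>{l \<in> L. x \<in> l}. finite {y \<in> i. collinear_points L z y}" using finl by auto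
    have "\<not> collinear_points L z x" using x z(1) z(2)[symmetric] z(3) by (auto simp: collinear_points_def E)
    show "\<forall>i\<in>{l \<in> L. x \<in> l}. \<forall>j\<in>{l \<in> L. x \<in> l}. i \<noteq> j \<longrightarrow>
        {y \<in> i. collinear_points L z y} \<inter> {y \<in> j. collinear_points L z y} = {}"
    proof (intro ballI impI equals0I)
      fix i j u
      assume ij: "i \<in> {l \<in> L. x \<in> l}" "j \<in> {l \<in> L. x \<in> l}" "i \<noteq> j"
        and u: "u \<in> {y \<in> i. collinear_points L z y} \<inter> {y \<in> j. collinear_points L z y}"
      then have "x = u" using uniq[of i j x u] by auto
      then show False using u \<open>\<not> collinear_points L z x\<close> by simp
    qed
  qed
  also have "\<dots> = (t + 1) * \<alpha>" using alpha(2)[OF z(1)] nl thr[OF x] by simp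
  finally have "(t + 1) * \<alpha> = card (\<Union>l\<in>{l \<in> L. x \<in> l}. {y \<in> l. collinear_points L z y})" by simp
  also have "\<dots> \<le> card (?E `` {x} \<inter> ?E `` {z})"
  proof (rule card_mono)
    show "finite (?E `` {x} \<inter> ?E `` {z})"
      by (rule finite_subset[OF _ finV]) (use E in blast)
    show "(\<Union>l\<in>{l \<in> L. x \<in> l}. {y \<in> l. collinear_points L z y}) \<subseteq> ?E `` {x} \<inter> ?E `` {z}"
    proof
      fix u assume "u \<in> (\<Union>l\<in>{l \<in> L. x \<in> l}. {y \<in> l. collinear_points L z y})"
      then obtain l where l: "l \<in> L" "x \<in> l" "u \<in> l" "collinear_points L z u" by blast
      have "u \<noteq> z" using nl l by blast
      moreover have "u \<noteq> x" using x z(1) z(2)[symmetric] z(3) l(4) by (auto simp: collinear_points_def E)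
      ultimately show "u \<in> ?E `` {x} \<inter> ?E `` {z}"
        using x z(1) l inV[OF l(1,3)] by (auto simp: collinear_points_def E)
    qed
  qed
  also have "\<dots> = q + 1" using G V x z by (simp add: srg_def)
  finally have "(t + 1) * \<alpha> \<le> q + 1" .
  then have "(q + 1) * \<alpha> \<le> (q + 1) * 1"
    using order_trans[OF mult_le_mono1[OF tq, of \<alpha>]] by (simp only: mult_1_right)
  then have "\<alpha> \<le> 1" by (subst (asm) mult_le_cancel1) simp
  then show ?thesis using alpha(1) by simp
qed

text \<open>Since \<open>\<alpha> = 1\<close>, a common neighbour off the line through \<open>x\<close> and \<open>y\<close> would be collinear with two points of
that line.\<close>

lemma geometric_imp_diamond_free:
  assumes geo: "geometric G" and G: "srg n (q * (q + 1)) (q - 1) (q + 1) G" and q: "q \<ge> 1"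
    and xy: "(x, y) \<in> parcs G" and z: "(x, z) \<in> parcs G" "(y, z) \<in> parcs G"
    and w: "(x, w) \<in> parcs G" "(y, w) \<in> parcs G" and zw: "z \<noteq> w"
  shows "(z, w) \<in> parcs G"
proof -
  obtain L s t \<alpha> where pg: "partial_geometry s t \<alpha> (pverts G) L"
    and GL: "G = collinearity_graph (pverts G) L" using geo by (auto simp: geometric_def)
  have "\<alpha> = 1"
    using partial_geometry_parameters[OF pg _ q] G GL by simp
  have E: "(x, y) \<in> parcs G \<longleftrightarrow> x \<in> pverts G \<and> y \<in> pverts G \<and> x \<noteq> y \<and> collinear_points L x y" for x y
    by (subst GL) (auto simp: collinearity_graph_def)
  obtain l where l: "l \<in> L" "x \<in> l" "y \<in> l" using xy E by (auto simp: collinear_points_def)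
  have on: "u \<in> l" if u: "(x, u) \<in> parcs G" "(y, u) \<in> parcs G" for u
  proof (rule ccontr)
    assume "u \<notin> l"
    moreover have "u \<in> pverts G" using u E by blast
    ultimately have "card {v \<in> l. collinear_points L u v} = 1"
      using pg l(1) \<open>\<alpha> = 1\<close> by (simp add: partial_geometry_def)
    moreover have "x \<in> {v \<in> l. collinear_points L u v}" "y \<in> {v \<in> l. collinear_points L u v}"
      using u E l by (auto simp: collinear_points_def)
    ultimately show False using xy E by (metis card_1_singletonE singletonD)
  qed
  have "collinear_points L z w" unfolding collinear_points_def using on[OF z] on[OF w] l(1) by blast
  then show ?thesis using zw z(1) w(1) unfolding E by simp
qed

lemma not_geometric_polarity_graph:
  assumes \<phi>: "bij_betw \<phi> V UNIV" and refl: "\<And>x. R x x" and sym: "\<And>x y. R x y \<Longrightarrow> R y x"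
    and G: "srg n (q * (q + 1)) (q - 1) (q + 1) (polarity_graph V (\<lambda>x y. R (\<phi> x) (\<phi> y)))" "q \<ge> 1"
    and v: "\<not> locally_linear R v"
  shows "\<not> geometric (polarity_graph V (\<lambda>x y. R (\<phi> x) (\<phi> y)))" (is "\<not> geometric ?G")
proof
  assume geo: "geometric ?G"
  obtain y z w where vy: "R v y" "y \<noteq> v" and zw: "R v z" "R y z" "R v w" "R y w" "\<not> R z w"
    using v by (auto simp: locally_linear_def spans_line_def)
  define \<theta> where "\<theta> = inv_into V \<phi>"
  have \<theta>: "\<theta> w \<in> V" "\<phi> (\<theta> w) = w" for w
    using \<phi> by (auto simp: \<theta>_def bij_betw_def inv_into_into f_inv_into_f)
  have E: "(\<theta> a, \<theta> b) \<in> parcs ?G \<longleftrightarrow> a \<noteq> b \<and> R a b" for a b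
    using \<theta> by (metis polarity_graph_simps(2))
  have ne: "v \<noteq> y" "v \<noteq> z" "v \<noteq> w" "y \<noteq> z" "y \<noteq> w" "z \<noteq> w" using vy(2) zw refl sym by blast+
  have ne': "\<theta> z \<noteq> \<theta> w" using ne(6) \<theta>(2)[of z] \<theta>(2)[of w] by auto
  have "(\<theta> z, \<theta> w) \<in> parcs ?G"
    by (rule geometric_imp_diamond_free[OF geo G, of "\<theta> v" "\<theta> y"])
      (use vy zw ne ne' in \<open>simp_all only: E simp_thms\<close>)
  then show False using zw(5) unfolding E by simp
qed

section \<open>The collinearity graph of W(q)\<close>

definition sform :: "'a::field^4 \<Rightarrow> 'a^4 \<Rightarrow> 'a" where
  "sform u v = u $ 1 * v $ 2 - u $ 2 * v $ 1 + u $ 3 * v $ 4 - u $ 4 * v $ 3"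

lemma symplectic_form_eq: "scalar_product u (symplectic_form_matrix *v v) = sform u v"
  by (simp add: scalar_product_def symplectic_form_matrix_def matrix_vector_mult_def sum_4
      vector_def sform_def)

lemma sform_simps:
  "sform u u = 0"
  "sform u (v + w) = sform u v + sform u w" "sform u (c *s v) = c * sform u v"
  "sform (c *s u) v = c * sform u v" "sform u (v - w) = sform u v - sform u w" "sform u 0 = 0"
  "sform (u - v) w = sform u w - sform v w"
  by (simp_all add: sform_def algebra_simps)

lemma sform_swap: "sform v u = - sform u v"
  by (simp add: sform_def algebra_simps)

lemma sform_nondegenerate:
  assumes "\<And>x. sform u x = 0"
  shows "u = 0"
proof -
  have "sform u (axis 1 1) = - u $ 2" "sform u (axis 2 1) = u $ 1"
    "sform u (axis 3 1) = - u $ 4" "sform u (axis 4 1) = u $ 3"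
    by (simp_all add: sform_def axis_def)
  then show ?thesis using assms by (simp add: Finite_Cartesian_Product.vec_eq_iff forall_4)
qed

definition sperp :: "'a::field^4 \<Rightarrow> ('a^4) set" where
  "sperp u = {v. sform u v = 0}"

lemma subspace_sperp: "vec.subspace (sperp u)"
  by (rule vec.subspaceI) (simp_all add: sperp_def sform_simps)

lemma pg3_points_eq: "(pg3_points :: ('a::field^4) set set) = {vec.span {u} | u. u \<noteq> 0}"
proof (intro equalityI subsetI)
  fix U :: "('a^4) set" assume "U \<in> pg3_points"
  then have U: "vec.subspace U" "vec.dim U = 1" by (auto simp: pg3_points_def)
  obtain B where B: "B \<subseteq> U" "vec.independent B" "U \<subseteq> vec.span B" "card B = vec.dim U"
    by (rule vec.basis_exists)
  then obtain u where "B = {u}" using U(2) by (metis card_1_singletonE)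
  moreover have "vec.span B = U" using B(1,3) U(1) vec.span_minimal by blast
  moreover have "u \<noteq> 0" using B(2) \<open>B = {u}\<close> vec.dependent_zero by blast
  ultimately show "U \<in> {vec.span {u} | u. u \<noteq> 0}" by blast
next
  fix U :: "('a^4) set" assume "U \<in> {vec.span {u} | u. u \<noteq> 0}"
  then show "U \<in> pg3_points"
    by (auto simp: pg3_points_def vec.dim_insert vec.subspace_span)
qed

lemma span_singleton_subset_iff:
  assumes "vec.subspace H"
  shows "vec.span {u} \<subseteq> H \<longleftrightarrow> u \<in> H"
  using assms vec.span_superset[of "{u}"] vec.span_minimal[of "{u}" H] by auto

lemma span_singleton_eq:
  assumes "x \<in> vec.span {u}" "x \<noteq> (0 :: 'a::field^4)"
  shows "vec.span {x} = vec.span {u}"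
proof -
  obtain k where k: "x = k *s u" using assms(1) by (auto simp: vec.span_singleton)
  then have "k \<noteq> 0" using assms(2) by auto
  then have "u = inverse k *s x" using k by simp
  then have "u \<in> vec.span {x}" by (auto simp: vec.span_singleton)
  with assms(1) show ?thesis
    by (intro equalityI) (simp_all add: span_singleton_subset_iff vec.subspace_span)
qed

text \<open>The points partition the non-zero vectors into sets of size \<open>q - 1\<close>.\<close>

lemma card_points_of_subspace:
  fixes H :: "('a::{field, finite}^4) set"
  assumes "vec.subspace H"
  shows "(CARD('a) - 1) * card {U \<in> pg3_points. U \<subseteq> H} = card H - 1"
proof -
  let ?P = "{U \<in> pg3_points. U \<subseteq> H}"
  have 0: "0 \<in> H" using assms vec.subspace_0 by blast
  have "H - {0} = (\<Union>U\<in>?P. U - {0})"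
  proof (intro equalityI subsetI)
    fix x assume x: "x \<in> H - {0}"
    then have "vec.span {x} \<in> ?P" "x \<in> vec.span {x}"
      using assms by (auto simp: pg3_points_eq span_singleton_subset_iff intro: vec.span_base)
    then show "x \<in> (\<Union>U\<in>?P. U - {0})" using x by blast
  qed auto
  then have "card (H - {0}) = card (\<Union>U\<in>?P. U - {0})" by simp
  also have "\<dots> = (\<Sum>U\<in>?P. card (U - {0}))"
  proof (rule card_UN_disjoint)
    have span: "U = vec.span {x}" if "U \<in> pg3_points" "x \<in> U" "x \<noteq> 0" for U and x :: "'a^4"
      using that span_singleton_eq[of x] by (auto simp: pg3_points_eq)
    show "\<forall>U\<in>?P. \<forall>V\<in>?P. U \<noteq> V \<longrightarrow> (U - {0}) \<inter> (V - {0}) = {}"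
    proof (intro ballI impI equals0I)
      fix U V x assume "U \<in> ?P" "V \<in> ?P" "U \<noteq> V" and x: "x \<in> (U - {0}) \<inter> (V - {0})"
      then show False using span[of U x] span[of V x] by simp
    qed
  qed auto
  also have "\<dots> = (\<Sum>U\<in>?P. CARD('a) - 1)"
  proof (rule sum.cong)
    fix U :: "('a^4) set" assume "U \<in> ?P"
    then obtain u where u: "U = range (\<lambda>k. k *s u)" "u \<noteq> 0"
      by (auto simp: pg3_points_eq vec.span_singleton)
    have "card U = CARD('a)" unfolding u(1)
      using u(2) by (intro card_image) (auto simp: inj_on_def)
    moreover have "0 \<in> U" unfolding u(1) by (rule range_eqI[of _ _ 0]) simp
    ultimately show "card (U - {0}) = CARD('a) - 1" by simp
  qed simp
  finally show ?thesis using 0 by (simp add: mult.commute)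
qed

text \<open>A vector on which the functional takes the value \<open>1\<close> spans a complement of the kernel.\<close>

lemma card_subspace_functional:
  fixes H :: "('a::{field, finite}^4) set" and f :: "'a^4 \<Rightarrow> 'a"
  assumes H: "vec.subspace H"
    and f: "\<And>x y. f (x + y) = f x + f y" "\<And>c x. f (c *s x) = c * f x"
    and x: "x \<in> H" "f x \<noteq> 0"
  shows "card H = CARD('a) * card {y \<in> H. f y = 0}"
proof -
  define e where "e = inverse (f x) *s x"
  have e: "e \<in> H" "f e = 1" using H x f(2) by (auto simp: e_def vec.subspace_scale)
  have "bij_betw (\<lambda>(c, y). y + c *s e) (UNIV \<times> {y \<in> H. f y = 0}) H"
  proof (rule bij_betw_byWitness[where f' = "\<lambda>z. (f z, z - f z *s e)"])
    have minus: "f (z - c *s e) = f z - c" for z c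
      using f(1)[of "z - c *s e" "c *s e"] f(2) e(2) by simp
    show "(\<lambda>z. (f z, z - f z *s e)) ` H \<subseteq> UNIV \<times> {y \<in> H. f y = 0}"
      using H e(1) by (auto simp: minus intro!: vec.subspace_diff vec.subspace_scale)
    show "(\<lambda>(c, y). y + c *s e) ` (UNIV \<times> {y \<in> H. f y = 0}) \<subseteq> H"
      using H e(1) by (auto intro!: vec.subspace_add vec.subspace_scale)
  qed (auto simp: f e)
  then have "card ((UNIV :: 'a set) \<times> {y \<in> H. f y = 0}) = card H"
    by (rule bij_betw_same_card)
  then show ?thesis by (simp add: card_cartesian_product)
qed

lemma card_sperp:
  fixes u :: "'a::{field, finite}^4"
  assumes "u \<noteq> 0"
  shows "card (sperp u) = CARD('a) ^ 3"
proof -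
  obtain x where "sform u x \<noteq> 0" using assms sform_nondegenerate by blast
  then have "card (UNIV :: ('a^4) set) = CARD('a) * card {y \<in> UNIV. sform u y = 0}"
    by (intro card_subspace_functional[where x = x]) (simp_all add: sform_simps vec.subspace_UNIV)
  then have "CARD('a) * CARD('a) ^ 3 = CARD('a) * card (sperp u)"
    by (simp add: sperp_def eval_nat_numeral)
  then show ?thesis by simp
qed

text \<open>If the functional of \<open>v\<close> vanished on the kernel of that of \<open>u\<close>, it would be a multiple of the latter, and
\<open>u\<close> and \<open>v\<close> would span the same point because the form is non-degenerate.\<close>

lemma card_sperp_Int:
  fixes u v :: "'a::{field, finite}^4"
  assumes "u \<noteq> 0" "v \<noteq> 0" "vec.span {u} \<noteq> vec.span {v}"
  shows "card (sperp u \<inter> sperp v) = CARD('a) ^ 2"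
proof -
  obtain y where y: "sform u y \<noteq> 0" using assms(1) sform_nondegenerate by blast
  have "\<exists>x\<in>sperp u. sform v x \<noteq> 0"
  proof (rule ccontr)
    assume none: "\<not> ?thesis"
    define c where "c = sform v y / sform u y"
    have "sform (v - c *s u) z = 0" for z
    proof -
      have "z - (sform u z / sform u y) *s y \<in> sperp u" using y by (simp add: sperp_def sform_simps)
      then have "sform v (z - (sform u z / sform u y) *s y) = 0" using none by blast
      then show ?thesis by (simp add: sform_simps c_def)
    qed
    then have "v = c *s u" using sform_nondegenerate[of "v - c *s u"] by simp
    then have "v \<in> vec.span {u}" by (auto simp: vec.span_singleton)
    then show False using span_singleton_eq assms(2,3) by blast
  qed
  then obtain x where "x \<in> sperp u" "sform v x \<noteq> 0" by blast
  then have "card (sperp u) = CARD('a) * card {y \<in> sperp u. sform v y = 0}"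
    by (intro card_subspace_functional[where x = x]) (simp_all add: sform_simps subspace_sperp)
  then have "CARD('a) * CARD('a) ^ 2 = CARD('a) * card (sperp u \<inter> sperp v)"
    using card_sperp[OF assms(1)] by (simp add: sperp_def Int_def eval_nat_numeral)
  then show ?thesis by simp
qed

definition orthogonal_points :: "('a::field^4) set \<Rightarrow> ('a^4) set \<Rightarrow> bool" where
  "orthogonal_points U V \<longleftrightarrow> (\<forall>u\<in>U. \<forall>v\<in>V. sform u v = 0)"

lemma orthogonal_points_span:
  "orthogonal_points (vec.span {u}) V \<longleftrightarrow> V \<subseteq> sperp u"
proof
  assume "orthogonal_points (vec.span {u}) V"
  then show "V \<subseteq> sperp u" by (auto simp: orthogonal_points_def sperp_def intro: vec.span_base)
next
  assume "V \<subseteq> sperp u"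
  then show "orthogonal_points (vec.span {u}) V"
    by (auto simp: orthogonal_points_def vec.span_singleton sform_simps sperp_def)
qed

lemma collinear_W_iff_orthogonal:
  fixes U V :: "('a::field^4) set"
  assumes "U \<in> pg3_points" "V \<in> pg3_points" "U \<noteq> V"
  shows "collinear_points W_lines U V \<longleftrightarrow> orthogonal_points U V"
proof
  assume "collinear_points W_lines U V"
  then obtain W where "U \<subseteq> W" "V \<subseteq> W" "totally_isotropic W"
    by (auto simp: collinear_points_def W_lines_def)
  then show "orthogonal_points U V"
    by (auto simp: orthogonal_points_def totally_isotropic_def symplectic_form_eq)
next
  assume orth: "orthogonal_points U V"
  obtain u v where uv: "U = vec.span {u}" "V = vec.span {v}" "u \<noteq> 0" "v \<noteq> 0"
    using assms by (auto simp: pg3_points_eq)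
  let ?W = "vec.span {v, u}"
  have "v \<notin> vec.span {u}" using span_singleton_eq uv assms(3) by blast
  then have "vec.dim ?W = 2" using uv(3) by (simp add: vec.dim_insert)
  moreover have "totally_isotropic ?W"
  proof -
    have 0: "sform u v = 0" using orth uv by (auto simp: orthogonal_points_def intro: vec.span_base)
    have "\<exists>a b. x = a *s u + b *s v" if "x \<in> ?W" for x
      using that by (auto simp: vec.span_insert vec.span_singleton algebra_simps) (metis add.commute)
    moreover have "sform (a *s u + b *s v) (c *s u + d *s v) = 0" for a b c d
    proof -
      have "sform (a *s u + b *s v) w = a * sform u w + b * sform v w" for w
        by (simp add: sform_def algebra_simps)
      moreover have "sform v u = 0" using sform_swap[of v u] 0 by simp
      ultimately show ?thesis using 0 by (simp add: sform_simps)
    qed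
    ultimately show ?thesis
      unfolding totally_isotropic_def symplectic_form_eq by metis
  qed
  ultimately have "{X \<in> pg3_points. X \<subseteq> ?W} \<in> W_lines"
    by (auto simp: W_lines_def pg3_lines_def vec.subspace_span)
  moreover have "U \<in> {X \<in> pg3_points. X \<subseteq> ?W}" "V \<in> {X \<in> pg3_points. X \<subseteq> ?W}"
    using assms uv(1,2) vec.span_mono[of "{u}" "{v, u}"] vec.span_mono[of "{v}" "{v, u}"] by auto
  ultimately show "collinear_points W_lines U V"
    unfolding collinear_points_def by (intro bexI[of _ "{X \<in> pg3_points. X \<subseteq> ?W}"] conjI)
qed

lemma W_graph_eq: "W_graph = polarity_graph pg3_points orthogonal_points"
  using collinear_W_iff_orthogonal
  by (auto simp: W_graph_def collinearity_graph_def polarity_graph_def)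

lemma card_pg3_points:
  assumes "CARD('a::{field, finite}) = q"
  shows "card (pg3_points :: ('a^4) set set) = (q + 1) * (q\<^sup>2 + 1)"
proof -
  have q: "q > 1" unfolding assms[symmetric]
    using card_mono[of "UNIV :: 'a set" "{0, 1}"] by simp
  have "(q - 1) * card (pg3_points :: ('a^4) set set) = q ^ 4 - 1"
    using card_points_of_subspace[of "UNIV :: ('a^4) set"] assms by (simp add: vec.subspace_UNIV)
  also have "q ^ 4 - 1 = (q - 1) * ((q + 1) * (q\<^sup>2 + 1))"
    by (cases q) (simp_all add: algebra_simps eval_nat_numeral)
  finally show ?thesis using q by (subst (asm) mult_cancel1) simp
qed

text \<open>By the previous counts the closed neighbourhood of a point consists of the points of a hyperplane, and two of
these share the points of a subspace of codimension \<open>2\<close>.\<close>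

lemma srg_W_graph:
  assumes "CARD('a::{field, finite}) = q"
  shows "srg ((q + 1) * (q\<^sup>2 + 1)) (q * (q + 1)) (q - 1) (q + 1) (W_graph :: ('a^4) set pair_pre_digraph)"
proof -
  have q: "q > 1" unfolding assms[symmetric]
    using card_mono[of "UNIV :: 'a set" "{0, 1}"] by simp
  let ?P = "pg3_points :: ('a^4) set set"
  have "srg (card ?P) (q * (q + 1)) (q + 1 - 2) (q + 1) (polarity_graph ?P orthogonal_points)"
  proof (rule srg_polarity_graph)
    show "finite ?P" by simp
    show "orthogonal_points U U" if "U \<in> ?P" for U
      using that by (auto simp: pg3_points_eq orthogonal_points_def vec.span_singleton sform_simps)
    show "orthogonal_points V U" if "orthogonal_points U V" for U V :: "('a^4) set"
    proof -
      have "sform v u = 0" if "sform u v = 0" for u v :: "'a^4"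
        using that sform_swap[of v u] by simp
      then show ?thesis using that by (simp add: orthogonal_points_def)
    qed
    show "card {Z \<in> ?P. orthogonal_points U Z} = Suc (q * (q + 1))" if U: "U \<in> ?P" for U
    proof -
      obtain u where u: "U = vec.span {u}" "u \<noteq> 0" using U by (auto simp: pg3_points_eq)
      have "(q - 1) * card {Z \<in> ?P. orthogonal_points U Z} = q ^ 3 - 1"
        unfolding u(1) orthogonal_points_span
        using card_points_of_subspace[OF subspace_sperp[of u]] card_sperp[OF u(2)] assms by simp
      also have "q ^ 3 - 1 = (q - 1) * Suc (q * (q + 1))"
        by (cases q) (simp_all add: algebra_simps eval_nat_numeral)
      finally show ?thesis using q by (subst (asm) mult_cancel1) simp
    qed
    show "card {Z \<in> ?P. orthogonal_points U Z \<and> orthogonal_points V Z} = q + 1"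
      if UV: "U \<in> ?P" "V \<in> ?P" "U \<noteq> V" for U V
    proof -
      obtain u v where uv: "U = vec.span {u}" "u \<noteq> 0" "V = vec.span {v}" "v \<noteq> 0"
        using UV(1,2) by (auto simp: pg3_points_eq)
      have "(q - 1) * card {Z \<in> ?P. orthogonal_points U Z \<and> orthogonal_points V Z} = q ^ 2 - 1"
        using card_points_of_subspace[of "sperp u \<inter> sperp v"] card_sperp_Int[of u v] UV(3) assms uv
        by (simp add: orthogonal_points_span vec.subspace_inter subspace_sperp)
      also have "q ^ 2 - 1 = (q - 1) * (q + 1)"
        by (cases q) (simp_all add: algebra_simps eval_nat_numeral)
      finally show ?thesis using q by (subst (asm) mult_cancel1) simp
    qed
    show "0 < q * (q + 1)" using q by simp
    have "card ?P = q * (q + 1) + 1 + q ^ 3"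
      using card_pg3_points[OF assms] by (simp add: algebra_simps eval_nat_numeral)
    then show "q * (q + 1) < card ?P - 1" using q by simp
  qed
  then show ?thesis using card_pg3_points[OF assms] by (simp add: W_graph_eq)
qed

section \<open>Gluing affine planes along parallel classes\<close>

text \<open>The lines of a finite net, each parallel class given by a labelling of its lines: lines of different classes
meet in exactly one point, and any two points are on a common line. For \<open>q + 1\<close> classes and labels from a
set of size \<open>q\<close> this is an affine plane of order \<open>q\<close>.\<close>

definition parallel_classes :: "('i \<Rightarrow> 's \<Rightarrow> 'a) \<Rightarrow> bool" where
  "parallel_classes h \<longleftrightarrow>
     (\<forall>j k. j \<noteq> k \<longrightarrow> bij (\<lambda>P. (h j P, h k P))) \<and> (\<forall>P Q. \<exists>j. h j P = h j Q)"

lemma parallel_classes_inj: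
  assumes "parallel_classes h" "j \<noteq> k" "h j P = h j Q" "h k P = h k Q"
  shows "P = Q"
proof -
  have "inj (\<lambda>P. (h j P, h k P))" using assms(1,2) by (auto simp: parallel_classes_def bij_def)
  then show ?thesis using assms(3,4) by (auto dest: injD)
qed

lemma parallel_classes_meet:
  assumes "parallel_classes h" "j \<noteq> k"
  obtains P where "h j P = a" "h k P = b"
proof -
  have "surj (\<lambda>P. (h j P, h k P))" using assms(1,2) by (auto simp: parallel_classes_def bij_def)
  from surjD[OF this, of "(a, b)"] obtain P where "(a, b) = (h j P, h k P)" by blast
  then show ?thesis using that by simp
qed

lemma card_meet:
  assumes "parallel_classes h" "j \<noteq> k"
  shows "card {P. h j P = a \<and> h k P = b} = 1"
proof -
  obtain P where "h j P = a" "h k P = b" using parallel_classes_meet[OF assms] .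
  then have "{P. h j P = a \<and> h k P = b} = {P}" using parallel_classes_inj[OF assms] by auto
  then show ?thesis by simp
qed

lemma card_label_in:
  fixes h :: "'i::finite \<Rightarrow> 's::finite \<Rightarrow> 'a::finite"
  assumes h: "parallel_classes h" and i: "CARD('i) > 1"
  shows "card {P. h j P \<in> C} = card C * CARD('a)"
proof -
  have "\<exists>k. j \<noteq> k"
  proof (rule ccontr)
    assume "\<nexists>k. j \<noteq> k"
    then have "UNIV = {j}" by auto
    then have "CARD('i) = card {j}" by simp
    then show False using i by simp
  qed
  then obtain k where k: "j \<noteq> k" by blast
  have "bij (\<lambda>P. (h j P, h k P))" using h k by (simp add: parallel_classes_def)
  then have "bij_betw (\<lambda>P. (h j P, h k P)) {P. h j P \<in> C} (C \<times> UNIV)"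
    by (auto simp: bij_betw_def inj_on_def bij_def surj_def image_iff) (metis fst_conv snd_conv)
  then have "card {P. h j P \<in> C} = card (C \<times> (UNIV :: 'a set))" by (rule bij_betw_same_card)
  then show ?thesis by (simp add: card_cartesian_product)
qed

lemma card_parallel_class:
  fixes h :: "'i::finite \<Rightarrow> 's::finite \<Rightarrow> 'a::finite"
  assumes "parallel_classes h" "CARD('i) > 1"
  shows "card {P. h j P = c} = CARD('a)" "card {P. c = h j P} = CARD('a)"
  using card_label_in[OF assms, of j "{c}"] by (simp_all add: eq_commute[of c])

lemma card_points_parallel_classes:
  fixes h :: "'i::finite \<Rightarrow> 's::finite \<Rightarrow> 'a::finite"
  assumes "parallel_classes h" "CARD('i) > 1"
  shows "CARD('s) = CARD('a) * CARD('a)"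
  using card_label_in[OF assms, of _ UNIV] by simp

text \<open>The vertex \<open>(i, None)\<close> is the point \<open>p\<^sub>i\<close> of the fixed line, the vertex \<open>(i, Some P)\<close> the point \<open>P\<close> of the plane
\<open>S\<^sub>i\<close>. The label \<open>g i j P\<close> names the line of the \<open>j\<close>-th class of \<open>S\<^sub>i\<close> through \<open>P\<close>, and the gluing bijections
are hidden in the choice of these names: lines with equal names correspond.\<close>

fun glue :: "('i \<Rightarrow> 'i \<Rightarrow> 's \<Rightarrow> 'a) \<Rightarrow> 'i \<times> 's option \<Rightarrow> 'i \<times> 's option \<Rightarrow> bool" where
  "glue g (i, None) (j, None) \<longleftrightarrow> True"
| "glue g (i, None) (j, Some Q) \<longleftrightarrow> i = j"
| "glue g (i, Some P) (j, None) \<longleftrightarrow> i = j"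
| "glue g (i, Some P) (j, Some Q) \<longleftrightarrow> g i j P = g j i Q"

lemma glue_refl: "glue g x x"
  by (cases x; cases "snd x") auto

lemma glue_sym: "glue g x y \<Longrightarrow> glue g y x"
  by (cases x; cases y; cases "snd x"; cases "snd y") auto

lemma card_glue_vertices:
  fixes A :: "'i::finite \<times> 's::finite option \<Rightarrow> bool"
  shows "card {z. A z} = card {k. A (k, None)} + (\<Sum>k\<in>UNIV. card {Q. A (k, Some Q)})"
proof -
  have eq: "{z. A z} = (\<lambda>k. (k, None)) ` {k. A (k, None)} \<union>
      (\<lambda>(k, Q). (k, Some Q)) ` (SIGMA k:UNIV. {Q. A (k, Some Q)})" (is "_ = ?M \<union> ?N")
  proof (intro equalityI subsetI)
    fix z assume z: "z \<in> {z. A z}"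
    then show "z \<in> ?M \<union> ?N" by (cases z; cases "snd z") (auto simp: image_iff)
  qed auto
  have "card {z. A z} = card ?M + card ?N"
    unfolding eq by (rule card_Un_disjoint) auto
  also have "card ?M = card {k. A (k, None)}" by (intro card_image) (auto simp: inj_on_def)
  also have "card ?N = card (SIGMA k:UNIV. {Q. A (k, Some Q)})"
    by (intro card_image) (auto simp: inj_on_def)
  finally show ?thesis by simp
qed

text \<open>A vertex \<open>(i, Some P)\<close> is adjacent to \<open>p\<^sub>i\<close> and to one line of \<open>q\<close> points in each of the \<open>q + 1\<close> planes; a
vertex \<open>p\<^sub>i\<close> is adjacent to \<open>q + 1\<close> clique points and to the \<open>q\<^sup>2\<close> points of its plane.\<close>

lemma card_glue_neighbours:
  fixes g :: "'i::finite \<Rightarrow> 'i \<Rightarrow> 's::finite \<Rightarrow> 'a::finite"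
  assumes g: "\<And>i. parallel_classes (g i)" and q: "CARD('a) = q" "CARD('i) = q + 1" "q > 0"
  shows "card {z. glue g x z} = Suc (q * (q + 1))"
proof -
  obtain i p where x: "x = (i, p)" by (cases x)
  have i1: "CARD('i) > 1" using q by simp
  show ?thesis
  proof (cases p)
    case None
    have "(\<Sum>k\<in>UNIV. card {Q :: 's. i = k}) = (\<Sum>k\<in>{i}. CARD('s))"
      by (rule sum.mono_neutral_cong_right) auto
    then show ?thesis using q card_points_parallel_classes[OF g i1]
      by (simp add: x None card_glue_vertices)
  next
    case (Some P)
    have "{k. i = k} = {i}" by auto
    then show ?thesis using q by (simp add: x Some card_glue_vertices card_parallel_class[OF g i1])
  qed
qed

text \<open>Points of different planes \<open>S\<^sub>i\<close>, \<open>S\<^sub>j\<close> determine in every plane a line of the \<open>i\<close>-th and one of the \<open>j\<close>-th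
class, which meet once. Two points of one plane \<open>S\<^sub>i\<close> agree in exactly one label \<open>k\<close>; they share \<open>p\<^sub>i\<close> and the
\<open>q\<close> points of a line of \<open>S\<^sub>k\<close>.\<close>

lemma card_glue_common_neighbours:
  fixes g :: "'i::finite \<Rightarrow> 'i \<Rightarrow> 's::finite \<Rightarrow> 'a::finite"
  assumes g: "\<And>i. parallel_classes (g i)" and q: "CARD('a) = q" "CARD('i) = q + 1" "q > 0"
    and xy: "x \<noteq> y"
  shows "card {z. glue g x z \<and> glue g y z} = q + 1"
proof -
  have i1: "CARD('i) > 1" using q by simp
  have clique_point: "card {z. glue g (i, None) z \<and> glue g (j, Some Q) z} = q + 1" for i j Q
  proof -
    have "(\<Sum>k\<in>UNIV. card {P. i = k \<and> g j k Q = g k j P}) = (\<Sum>k\<in>{i}. card {P. g j k Q = g k j P})"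
      by (rule sum.mono_neutral_cong_right) auto
    moreover have "{k. j = k} = {j}" by auto
    ultimately show ?thesis
      using q by (simp add: card_glue_vertices card_parallel_class[OF g i1])
  qed
  obtain i p j r where x: "x = (i, p)" and y: "y = (j, r)" by (cases x, cases y)
  show ?thesis
  proof (cases p)
    case None
    show ?thesis
    proof (cases r)
      case r: None
      then have "i \<noteq> j" using xy None x y by simp
      then have "{Q :: 's. i = k \<and> j = k} = {}" for k by auto
      then show ?thesis using q by (simp add: x y None r card_glue_vertices)
    next
      case (Some Q)
      then show ?thesis using clique_point by (simp add: x y None)
    qed
  next
    case p: (Some P)
    show ?thesis
    proof (cases r)
      case None
      then show ?thesis using clique_point[of j i P] by (simp add: x y p conj_commute)
    next
      case r: (Some Q)
      show ?thesis
      proof (cases "i = j")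
        case False
        have "card {Z. g i k P = g k i Z \<and> g j k Q = g k j Z} = 1" for k
          using card_meet[OF g False, of k] by (simp add: eq_commute)
        moreover have "{k. i = k \<and> j = k} = {}" using False by auto
        ultimately show ?thesis using q by (simp add: x y p r card_glue_vertices)
      next
        case True
        then have PQ: "P \<noteq> Q" using xy by (simp add: x y p r)
        have "\<exists>k. g i k P = g i k Q" using g[of i] by (simp add: parallel_classes_def)
        then obtain k where k: "g i k P = g i k Q" by blast
        have "l = k" if "g i l P = g i l Q" for l
          using parallel_classes_inj[OF g _ that k] PQ by blast
        then have "(\<Sum>l\<in>UNIV. card {Z. g i l P = g l i Z \<and> g i l Q = g l i Z}) =
            (\<Sum>l\<in>{k}. card {Z. g i l P = g l i Z})"
          by (intro sum.mono_neutral_cong_right) (auto simp: k intro!: arg_cong[where f = card])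
        moreover have "{k. j = k} = {j}" by auto
        ultimately show ?thesis
          using q True by (simp add: x y p r card_glue_vertices card_parallel_class[OF g i1])
      qed
    qed
  qed
qed

text \<open>The neighbours of \<open>p\<^sub>i\<close> fall apart into the rest of the fixed line and the lines of one parallel class of
\<open>S\<^sub>i\<close>.\<close>

lemma locally_linear_clique_point: "locally_linear (glue g) (i, None)"
  unfolding locally_linear_def spans_line_def
proof (intro allI impI, elim conjE)
  fix y z w
  assume xy: "glue g (i, None) y" "y \<noteq> (i, None)" and z: "glue g (i, None) z" "glue g y z"
    and w: "glue g (i, None) w" "glue g y w"
  obtain j p k r l s where v: "y = (j, p)" "z = (k, r)" "w = (l, s)" by (cases y, cases z, cases w)
  show "glue g z w" using xy z w unfolding v by (cases p; cases r; cases s) auto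
qed

text \<open>Among the neighbours of a point \<open>P\<close> of \<open>S\<^sub>i\<close>, those in \<open>S\<^sub>i\<close> together with \<open>p\<^sub>i\<close> form a clique without edges to
the remaining ones, and distinct neighbours in one other plane are not adjacent. Hence only transitivity
across three further planes has to be checked.\<close>

lemma locally_linear_plane_point:
  assumes g: "\<And>i. parallel_classes (g i)"
    and quad: "\<And>k l m Qk Ql Qm. distinct [i, k, l, m] \<Longrightarrow>
      g i k P = g k i Qk \<Longrightarrow> g i l P = g l i Ql \<Longrightarrow> g i m P = g m i Qm \<Longrightarrow>
      g k l Qk = g l k Ql \<Longrightarrow> g k m Qk = g m k Qm \<Longrightarrow> g l m Ql = g m l Qm"
  shows "locally_linear (glue g) (i, Some P)"
proof -
  let ?x = "(i, Some P)"
  have internal: "z = (i, None) \<or> (\<exists>Q'. z = (i, Some Q') \<and> g i i P = g i i Q')"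
    if y: "glue g ?x (i, q)" "q \<noteq> Some P" and z: "glue g ?x z" "glue g (i, q) z" for q z
  proof (cases q)
    case None
    obtain k r where "z = (k, r)" by (cases z)
    then show ?thesis using z None by (cases r) auto
  next
    case (Some Q)
    obtain k r where kr: "z = (k, r)" by (cases z)
    show ?thesis
    proof (cases r)
      case None
      then show ?thesis using z kr by simp
    next
      case r: (Some Q')
      then have "g i k P = g i k Q" "g i i P = g i i Q" using y z Some kr by simp_all
      then have "k = i" using parallel_classes_inj[OF g, of k i i P Q] y(2) Some by auto
      then show ?thesis using z kr r by simp
    qed
  qed
  have external: "z = ?x \<or> z = (k, Some Q) \<or>
      (\<exists>l Q'. z = (l, Some Q') \<and> l \<noteq> i \<and> l \<noteq> k \<and> g i l P = g l i Q' \<and> g k l Q = g l k Q')"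
    if y: "glue g ?x (k, Some Q)" "k \<noteq> i" and z: "glue g ?x z" "glue g (k, Some Q) z" for k Q z
  proof -
    obtain l r where lr: "z = (l, r)" by (cases z)
    have "r \<noteq> None" using y(2) z lr by (cases r) auto
    then obtain Q' where r: "r = Some Q'" by auto
    have e: "g i l P = g l i Q'" "g k l Q = g l k Q'" "g i k P = g k i Q" using y z lr r by simp_all
    show ?thesis
    proof (cases "l = i \<or> l = k")
      case True
      then show ?thesis
        using parallel_classes_inj[OF g, of i k i P Q'] parallel_classes_inj[OF g, of i k k Q Q'] e y(2)
        by (auto simp: lr r)
    qed (use e lr r in auto)
  qed
  show ?thesis
    unfolding locally_linear_def spans_line_def
  proof (intro allI impI, elim conjE)
    fix y z w
    assume y: "glue g ?x y" "y \<noteq> ?x" and z: "glue g ?x z" "glue g y z"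
      and w: "glue g ?x w" "glue g y w"
    obtain k q where kq: "y = (k, q)" by (cases y)
    show "glue g z w"
    proof (cases "k = i")
      case True
      then have iq: "y = (i, q)" "glue g ?x (i, q)" "q \<noteq> Some P" using y kq by auto
      show ?thesis
        using internal[OF iq(2,3) z(1) z(2)[unfolded iq(1)]]
          internal[OF iq(2,3) w(1) w(2)[unfolded iq(1)]] by auto
    next
      case False
      then obtain Q where q: "q = Some Q" using y kq by (cases q) auto
      then have ky: "y = (k, Some Q)" using kq by simp
      note ext = external[of k Q, folded ky, OF y(1) False]
      consider "z = ?x \<or> z = y \<or> w = ?x \<or> w = y" |
        l Ql m Qm where "z = (l, Some Ql)" "l \<noteq> i" "l \<noteq> k" "g i l P = g l i Ql" "g k l Q = g l k Ql"
          "w = (m, Some Qm)" "m \<noteq> i" "m \<noteq> k" "g i m P = g m i Qm" "g k m Q = g m k Qm"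
        using ext[OF z] ext[OF w] by blast
      then show ?thesis
      proof cases
        case 1
        then show ?thesis using y z w glue_sym by blast
      next
        case 2
        have yk: "g i k P = g k i Q" using y(1) kq q by simp
        show ?thesis
        proof (cases "l = m")
          case True
          then have "Ql = Qm"
            using parallel_classes_inj[OF g, of i k l Ql Qm] 2 False by auto
          then show ?thesis using 2 True by simp
        next
          case lm: False
          then have "g l m Ql = g m l Qm"
            using 2 False yk by (intro quad[of k l m Q Ql Qm]) auto
          then show ?thesis using 2 by simp
        qed
      qed
    qed
  qed
qed

section \<open>The affine plane over a field and the transversal lines of W(q)\<close>

text \<open>The \<open>j\<close>-th class consists of the lines of slope \<open>j\<close>, and \<open>None\<close> stands for the vertical direction. In \<open>W(q)\<close>
take the line spanned by \<open>e\<^sub>1\<close> and \<open>e\<^sub>3\<close> with the points \<open>e\<^sub>1 + i e\<^sub>3\<close> and \<open>e\<^sub>3\<close>. The vector \<open>(a, -i, b, 1)\<close>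
represents the point \<open>(a, b)\<close> of the plane of \<open>e\<^sub>1 + i e\<^sub>3\<close>, and \<open>(a, 1, b, 0)\<close> that of the plane of \<open>e\<^sub>3\<close>. Two
such points of the planes \<open>i\<close> and \<open>j\<close> are then orthogonal if and only if the \<open>j\<close>-label of the first is the
\<open>i\<close>-label of the second.\<close>

fun dir_label :: "'a::field option \<Rightarrow> 'a \<times> 'a \<Rightarrow> 'a" where
  "dir_label None (a, b) = a"
| "dir_label (Some j) (a, b) = b - j * a"

lemma parallel_classes_dir_label: "parallel_classes (dir_label :: 'a::{field, finite} option \<Rightarrow> _)"
  unfolding parallel_classes_def
proof (intro conjI allI impI)
  fix j k :: "'a option" assume "j \<noteq> k"
  have "inj (\<lambda>P. (dir_label j P, dir_label k P))"
  proof (rule injI, clarify)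
    fix a b c d :: 'a
    assume e: "dir_label j (a, b) = dir_label j (c, d)" "dir_label k (a, b) = dir_label k (c, d)"
    show "a = c \<and> b = d"
    proof (cases j; cases k)
      fix m n assume mn: "j = Some m" "k = Some n"
      have "b - d = m * (a - c)" "b - d = n * (a - c)" using e mn by (simp_all add: algebra_simps)
      then have "(m - n) * (a - c) = 0" by (auto simp: left_diff_distrib)
      then have "a = c" using mn \<open>j \<noteq> k\<close> by auto
      then show ?thesis using e mn by simp
    qed (use e \<open>j \<noteq> k\<close> in auto)
  qed
  then show "bij (\<lambda>P. (dir_label j P, dir_label k P))"
    by (simp add: bij_def finite_UNIV_inj_surj)
next
  fix P Q :: "'a \<times> 'a"
  obtain a b c d where PQ: "P = (a, b)" "Q = (c, d)" by (cases P, cases Q)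
  show "\<exists>j. dir_label j P = dir_label j Q"
  proof (cases "a = c")
    case True
    then show ?thesis by (intro exI[of _ None]) (simp add: PQ)
  next
    case False
    then have "b - (b - d) / (a - c) * a = d - (b - d) / (a - c) * c" by (simp add: field_simps)
    then show ?thesis by (intro exI[of _ "Some ((b - d) / (a - c))"]) (simp add: PQ)
  qed
qed

lemma parallel_classes_relabel:
  assumes h: "parallel_classes h" and \<tau>: "\<And>j. bij (\<tau> j)"
  shows "parallel_classes (\<lambda>j P. \<tau> j (h j P))"
  unfolding parallel_classes_def
proof (intro conjI allI impI)
  fix j k :: 'a assume jk: "j \<noteq> k"
  have "bij (map_prod (\<tau> j) (\<tau> k) \<circ> (\<lambda>P. (h j P, h k P)))"
  proof (rule bij_comp)
    show "bij (\<lambda>P. (h j P, h k P))" using h jk by (simp add: parallel_classes_def)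
    show "bij (map_prod (\<tau> j) (\<tau> k))" using \<tau> by (simp add: bij_def prod.inj_map map_prod_surj)
  qed
  then show "bij (\<lambda>P. (\<tau> j (h j P), \<tau> k (h k P)))" by (simp add: comp_def)
next
  fix P Q
  show "\<exists>j. \<tau> j (h j P) = \<tau> j (h j Q)" using h by (metis parallel_classes_def)
qed

text \<open>The lines of \<open>W(q)\<close> disjoint from the fixed line meet every plane once and form a family with three
parameters; \<open>line_point c i\<close> is the point of the line \<open>c\<close> in the \<open>i\<close>-th plane.\<close>

fun line_point :: "'a::field \<times> 'a \<times> 'a \<Rightarrow> 'a option \<Rightarrow> 'a \<times> 'a" where
  "line_point (\<alpha>, \<beta>, \<gamma>) None = (\<alpha>, \<beta>)"
| "line_point (\<alpha>, \<beta>, \<gamma>) (Some k) = (\<beta> - k * \<alpha>, \<gamma> - k * \<beta>)"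

lemma line_points_adjacent: "dir_label l (line_point c k) = dir_label k (line_point c l)"
  by (cases c; cases k; cases l) (simp_all add: algebra_simps)

lemma line_through:
  assumes "i \<noteq> j" "dir_label j P = dir_label i Q"
  obtains c where "P = line_point c i" "Q = line_point c j"
proof -
  obtain a b a' b' where PQ: "P = (a, b)" "Q = (a', b')" by (cases P, cases Q)
  have "\<exists>c. P = line_point c i \<and> Q = line_point c j"
  proof (cases i)
    case None
    then obtain k where "j = Some k" using assms(1) by (cases j) auto
    then show ?thesis using None assms(2)
      by (intro exI[of _ "(a, b, b' + k * b)"]) (simp add: PQ)
  next
    case i: (Some k)
    show ?thesis
    proof (cases j)
      case None
      then show ?thesis using i assms(2)
        by (intro exI[of _ "(a', b', b + k * b')"]) (simp add: PQ)
    next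
      case j: (Some l)
      define \<alpha> where "\<alpha> = (a - a') / (l - k)"
      have "l - k \<noteq> 0" using i j assms(1) by auto
      then have "(l - k) * \<alpha> = a - a'" by (simp add: \<alpha>_def)
      then have a': "a' = a + k * \<alpha> - l * \<alpha>" by (simp add: algebra_simps)
      have "b - l * a = b' - k * a'" using i j assms(2) by (simp add: PQ)
      then have b': "b' = b - l * a + k * a'" by (simp add: algebra_simps)
      show ?thesis using i j
        by (intro exI[of _ "(\<alpha>, a + k * \<alpha>, b + k * (a + k * \<alpha>))"]) (simp add: PQ b' a' algebra_simps)
    qed
  qed
  then show ?thesis using that by blast
qed

lemma line_point_unique:
  fixes P :: "'a::{field, finite} \<times> 'a"
  assumes "i \<noteq> j" "dir_label i P = dir_label k (line_point c i)" "dir_label j P = dir_label k (line_point c j)"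
  shows "P = line_point c k"
  using parallel_classes_inj[OF parallel_classes_dir_label assms(1)] assms(2,3) line_points_adjacent by metis

text \<open>In \<open>W(q)\<close> three points adjacent to \<open>P\<close>, one of them adjacent to the other two, lie with \<open>P\<close> on one line.\<close>

lemma dir_label_quad:
  fixes P :: "'a::{field, finite} \<times> 'a"
  assumes "distinct [i, k, l, m]"
    and "dir_label k P = dir_label i Qk" "dir_label l P = dir_label i Ql" "dir_label m P = dir_label i Qm"
    and "dir_label l Qk = dir_label k Ql" "dir_label m Qk = dir_label k Qm"
  shows "dir_label m Ql = dir_label l Qm"
proof -
  have ne: "i \<noteq> k" using assms(1) by simp
  obtain c where c: "P = line_point c i" "Qk = line_point c k"
    using line_through[OF ne assms(2)] .
  have "Ql = line_point c l"
    by (rule line_point_unique[OF ne]) (use assms c in simp_all)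
  moreover have "Qm = line_point c m"
    by (rule line_point_unique[OF ne]) (use assms c in simp_all)
  ultimately show ?thesis by (simp add: line_points_adjacent)
qed

section \<open>Twisting one gluing\<close>

text \<open>A pair \<open>(i, j)\<close> in \<open>S\<close> means that the bijection between the \<open>j\<close>-th class of the plane \<open>i\<close> and the \<open>i\<close>-th
class of the plane \<open>j\<close> is altered by \<open>\<pi>\<close>. The set \<open>S\<close> is not meant to be symmetric: renaming the lines on
both sides alike would not change the gluing.\<close>

definition twisted_label ::
    "('a::field option \<times> 'a option) set \<Rightarrow> ('a \<Rightarrow> 'a) \<Rightarrow> 'a option \<Rightarrow> 'a option \<Rightarrow> 'a \<times> 'a \<Rightarrow> 'a" where
  "twisted_label S \<pi> i j P = (if (i, j) \<in> S then \<pi> (dir_label j P) else dir_label j P)"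

abbreviation twisted :: "('a::field option \<times> 'a option) set \<Rightarrow> ('a \<Rightarrow> 'a) \<Rightarrow>
    'a option \<times> ('a \<times> 'a) option \<Rightarrow> 'a option \<times> ('a \<times> 'a) option \<Rightarrow> bool" where
  "twisted S \<pi> \<equiv> glue (twisted_label S \<pi>)"

lemma parallel_classes_twisted_label:
  fixes \<pi> :: "'a::{field, finite} \<Rightarrow> 'a"
  assumes "bij \<pi>"
  shows "parallel_classes (twisted_label S \<pi> i)"
proof -
  have "parallel_classes (\<lambda>j P. (if (i, j) \<in> S then \<pi> else id) (dir_label j P))"
    by (rule parallel_classes_relabel[OF parallel_classes_dir_label]) (simp add: assms bij_id[unfolded id_def])
  moreover have "(\<lambda>j P. (if (i, j) \<in> S then \<pi> else id) (dir_label j P)) = twisted_label S \<pi> i"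
    by (auto simp: twisted_label_def fun_eq_iff)
  ultimately show ?thesis by simp
qed

lemma ex_fresh_option:
  fixes a b c :: "'a::finite option"
  assumes "CARD('a) \<ge> 3"
  obtains k where "k \<noteq> a" "k \<noteq> b" "k \<noteq> c"
proof -
  have "card {a, b, c} \<le> 3" by (simp add: card_insert_if)
  then have "card {a, b, c} < CARD('a option)" using assms by simp
  then have "{a, b, c} \<noteq> UNIV" by auto
  then show ?thesis using that by blast
qed

text \<open>The stabilizer of the fixed line in the group of \<open>W(q)\<close> permutes the pairs of planes transitively, so this
choice of a pair only fixes coordinates.\<close>

definition single_twist :: "('a::field option \<times> 'a option) set" where
  "single_twist = {(None, Some 0)}"

lemma spans_line_sym: "spans_line R x y \<longleftrightarrow> spans_line R y x"
  unfolding spans_line_def by blast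

lemma not_spans_lineI:
  assumes "R x z" "R y z" "R x w" "R y w" "\<not> R z w"
  shows "\<not> spans_line R x y"
  using assms unfolding spans_line_def by blast

text \<open>Both planes of the twisted pair give a line of \<open>W(q)\<close> the same label, the second parameter; after twisting,
the line stays a clique if and only if \<open>\<pi>\<close> fixes this label.\<close>

lemma line_label:
  "dir_label (Some 0) (line_point c None) = fst (snd c)"
  "dir_label None (line_point c (Some 0)) = fst (snd c)"
  by (cases c; simp)+

lemma single_twist_untwisted_edge:
  fixes c :: "'a::field \<times> 'a \<times> 'a"
  assumes "{k, l} \<noteq> {None, Some 0}"
  shows "twisted single_twist \<pi> (k, Some (line_point c k)) (l, Some (line_point c l))"
  using assms line_points_adjacent[of l c k] by (auto simp: twisted_label_def single_twist_def)

lemma single_twist_twisted_edge: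
  "twisted single_twist \<pi> (None, Some P) (Some 0, Some Q) \<longleftrightarrow> \<pi> (dir_label (Some 0) P) = dir_label None Q"
  by (simp add: twisted_label_def single_twist_def)

text \<open>All lines through \<open>P\<close> carry the label of \<open>P\<close>. If \<open>\<pi>\<close> fixes it, \<open>\<pi>\<close> disappears from all conditions on
neighbours of \<open>P\<close> and the property of \<open>W(q)\<close> applies.\<close>

lemma single_twist_fixed_None:
  fixes \<pi> :: "'a::{field, finite} \<Rightarrow> 'a"
  assumes \<pi>: "bij \<pi>" and fixed: "\<pi> (dir_label (Some 0) P) = dir_label (Some 0) P"
  shows "locally_linear (twisted single_twist \<pi>) (None, Some P)"
proof (rule locally_linear_plane_point)
  show "parallel_classes (twisted_label single_twist \<pi> i)" for i
    by (rule parallel_classes_twisted_label[OF \<pi>])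
  fix k l m Qk Ql Qm
  assume d: "distinct [None, k, l, m]"
    and "twisted_label single_twist \<pi> None k P = twisted_label single_twist \<pi> k None Qk"
      "twisted_label single_twist \<pi> None l P = twisted_label single_twist \<pi> l None Ql"
      "twisted_label single_twist \<pi> None m P = twisted_label single_twist \<pi> m None Qm"
      "twisted_label single_twist \<pi> k l Qk = twisted_label single_twist \<pi> l k Ql"
      "twisted_label single_twist \<pi> k m Qk = twisted_label single_twist \<pi> m k Qm"
  then have "dir_label m Ql = dir_label l Qm"
    using fixed by (intro dir_label_quad[OF d, of P Qk]) (auto simp: twisted_label_def single_twist_def split: if_splits)
  then show "twisted_label single_twist \<pi> l m Ql = twisted_label single_twist \<pi> m l Qm"
    using d by (auto simp: twisted_label_def single_twist_def)
qed

lemma single_twist_fixed_Some_0: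
  fixes \<pi> :: "'a::{field, finite} \<Rightarrow> 'a"
  assumes \<pi>: "bij \<pi>" and fixed: "\<pi> (dir_label None P) = dir_label None P"
  shows "locally_linear (twisted single_twist \<pi>) (Some 0, Some P)"
proof (rule locally_linear_plane_point)
  show "parallel_classes (twisted_label single_twist \<pi> i)" for i
    by (rule parallel_classes_twisted_label[OF \<pi>])
  have inj: "\<pi> x = \<pi> y \<longleftrightarrow> x = y" for x y using \<pi> by (simp add: bij_def inj_eq)
  have untwist: "dir_label k P = dir_label (Some 0) Q"
    if "twisted_label single_twist \<pi> (Some 0) k P = twisted_label single_twist \<pi> k (Some 0) Q" for k Q
    using that fixed inj[of "dir_label None P" "dir_label (Some 0) Q"]
    by (auto simp: twisted_label_def single_twist_def split: if_splits)
  fix k l m Qk Ql Qm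
  assume d: "distinct [Some 0, k, l, m]"
    and e: "twisted_label single_twist \<pi> (Some 0) k P = twisted_label single_twist \<pi> k (Some 0) Qk"
      "twisted_label single_twist \<pi> (Some 0) l P = twisted_label single_twist \<pi> l (Some 0) Ql"
      "twisted_label single_twist \<pi> (Some 0) m P = twisted_label single_twist \<pi> m (Some 0) Qm"
    and f: "twisted_label single_twist \<pi> k l Qk = twisted_label single_twist \<pi> l k Ql"
      "twisted_label single_twist \<pi> k m Qk = twisted_label single_twist \<pi> m k Qm"
  have "dir_label m Ql = dir_label l Qm"
    using f d by (intro dir_label_quad[OF d untwist[OF e(1)] untwist[OF e(2)] untwist[OF e(3)]])
      (auto simp: twisted_label_def single_twist_def split: if_splits)
  then show "twisted_label single_twist \<pi> l m Ql = twisted_label single_twist \<pi> m l Qm"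
    using d by (auto simp: twisted_label_def single_twist_def)
qed

text \<open>The edge is on a line of \<open>W(q)\<close> whose points in the planes \<open>None\<close> and \<open>Some 0\<close> are still common neighbours but
no longer adjacent.\<close>

lemma single_twist_bad_edge_outside:
  fixes c :: "'a::field \<times> 'a \<times> 'a"
  assumes kl: "k \<noteq> None" "k \<noteq> Some 0" "l \<noteq> None" "l \<noteq> Some 0"
    and moved: "\<pi> (fst (snd c)) \<noteq> fst (snd c)"
  shows "\<not> spans_line (twisted single_twist \<pi>) (k, Some (line_point c k)) (l, Some (line_point c l))"
proof (rule not_spans_lineI)
  let ?x = "\<lambda>k. (k, Some (line_point c k))"
  show "twisted single_twist \<pi> (?x k) (?x None)" "twisted single_twist \<pi> (?x l) (?x None)"
    "twisted single_twist \<pi> (?x k) (?x (Some 0))" "twisted single_twist \<pi> (?x l) (?x (Some 0))"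
    by (rule single_twist_untwisted_edge; use kl in auto)+
  show "\<not> twisted single_twist \<pi> (?x None) (?x (Some 0))"
    unfolding single_twist_twisted_edge line_label using moved .
qed

text \<open>The edge joins two points that are not adjacent in \<open>W(q)\<close>. Their common neighbours in the remaining planes are
the same as in \<open>W(q)\<close>, and no two of them are adjacent, for otherwise the line of \<open>W(q)\<close> through these would
contain both end points.\<close>

lemma single_twist_bad_edge_twisted:
  fixes \<pi> :: "'a::{field, finite} \<Rightarrow> 'a"
  assumes q: "CARD('a) \<ge> 3" and edge: "\<pi> (dir_label (Some 0) P) = dir_label None Q"
    and moved: "\<pi> (dir_label (Some 0) P) \<noteq> dir_label (Some 0) P"
  shows "\<not> spans_line (twisted single_twist \<pi>) (None, Some P) (Some 0, Some Q)"
proof -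
  obtain k :: "'a option" where k: "k \<noteq> None" "k \<noteq> Some 0" by (rule ex_fresh_option[OF q])
  obtain l where l: "l \<noteq> None" "l \<noteq> Some 0" "l \<noteq> k" by (rule ex_fresh_option[OF q])
  obtain V where V: "dir_label None V = dir_label k P" "dir_label (Some 0) V = dir_label k Q"
    by (rule parallel_classes_meet[OF parallel_classes_dir_label]) auto
  obtain W where W: "dir_label None W = dir_label l P" "dir_label (Some 0) W = dir_label l Q"
    by (rule parallel_classes_meet[OF parallel_classes_dir_label]) auto
  show ?thesis
  proof (rule not_spans_lineI)
    show "twisted single_twist \<pi> (None, Some P) (k, Some V)" "twisted single_twist \<pi> (Some 0, Some Q) (k, Some V)"
      "twisted single_twist \<pi> (None, Some P) (l, Some W)" "twisted single_twist \<pi> (Some 0, Some Q) (l, Some W)"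
      using k l V W by (auto simp: twisted_label_def single_twist_def)
    show "\<not> twisted single_twist \<pi> (k, Some V) (l, Some W)"
    proof
      assume "twisted single_twist \<pi> (k, Some V) (l, Some W)"
      then have "dir_label l V = dir_label k W" using k l by (simp add: twisted_label_def single_twist_def)
      then obtain c where c: "V = line_point c k" "W = line_point c l"
        using line_through[OF l(3)[symmetric]] by metis
      have "P = line_point c None" "Q = line_point c (Some 0)"
        by (rule line_point_unique[OF l(3)]; use V W c in simp)+
      then show False using edge moved by (simp add: line_label)
    qed
  qed
qed

lemma single_twist_moved_None:
  fixes \<pi> :: "'a::{field, finite} \<Rightarrow> 'a"
  assumes "CARD('a) \<ge> 3" "\<pi> (dir_label (Some 0) P) \<noteq> dir_label (Some 0) P"
  shows "\<not> locally_linear (twisted single_twist \<pi>) (None, Some P)"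
proof -
  obtain Q where "dir_label None Q = \<pi> (dir_label (Some 0) P)"
    by (rule parallel_classes_meet[OF parallel_classes_dir_label, of None "Some 0"]) auto
  then show ?thesis
    using single_twist_bad_edge_twisted[of \<pi> P Q] assms single_twist_twisted_edge[of \<pi> P Q]
    unfolding locally_linear_def by force
qed

lemma single_twist_moved_Some_0:
  fixes \<pi> :: "'a::{field, finite} \<Rightarrow> 'a"
  assumes q: "CARD('a) \<ge> 3" and \<pi>: "bij \<pi>" and moved: "\<pi> (dir_label None Q) \<noteq> dir_label None Q"
  shows "\<not> locally_linear (twisted single_twist \<pi>) (Some 0, Some Q)"
proof -
  obtain b where b: "\<pi> b = dir_label None Q" using \<pi> by (metis bij_pointE)
  obtain P where P: "dir_label (Some 0) P = b"
    by (rule parallel_classes_meet[OF parallel_classes_dir_label, of None "Some 0"]) auto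
  have "\<pi> b \<noteq> b" using b moved by auto
  then have "\<not> spans_line (twisted single_twist \<pi>) (Some 0, Some Q) (None, Some P)"
    using single_twist_bad_edge_twisted[OF q, of \<pi> P Q] b P spans_line_sym by metis
  moreover have "twisted single_twist \<pi> (Some 0, Some Q) (None, Some P)"
    using single_twist_twisted_edge[of \<pi> P Q] b P glue_sym by metis
  ultimately show ?thesis unfolding locally_linear_def by blast
qed

text \<open>Through a point of a plane not involved in the twist there are lines with every label, in particular one with
a label that \<open>\<pi>\<close> moves.\<close>

lemma single_twist_moved_outside:
  fixes \<pi> :: "'a::{field, finite} \<Rightarrow> 'a"
  assumes q: "CARD('a) \<ge> 3" and b: "\<pi> b \<noteq> b" and k: "k \<noteq> None" "k \<noteq> Some 0"
  shows "\<not> locally_linear (twisted single_twist \<pi>) (k, Some P)"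
proof -
  obtain H where H: "dir_label (Some 0) H = b" "dir_label k H = dir_label None P"
    by (rule parallel_classes_meet[OF parallel_classes_dir_label k(2)[symmetric]])
  obtain c where c: "H = line_point c None" "P = line_point c k"
    using line_through[OF k(1)[symmetric] H(2)] .
  obtain l where l: "l \<noteq> None" "l \<noteq> Some 0" "l \<noteq> k" by (rule ex_fresh_option[OF q])
  have "fst (snd c) = b" using H(1) c(1) line_label(1)[of c] by simp
  then have "\<not> spans_line (twisted single_twist \<pi>) (k, Some P) (l, Some (line_point c l))"
    unfolding c(2) using b by (intro single_twist_bad_edge_outside k l) simp
  moreover have "twisted single_twist \<pi> (k, Some P) (l, Some (line_point c l))"
    unfolding c(2) by (rule single_twist_untwisted_edge) (use k l in auto)
  ultimately show ?thesis using l(3) unfolding locally_linear_def by blast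
qed

lemma card_locally_linear_single_twist:
  fixes \<pi> :: "'a::{field, finite} \<Rightarrow> 'a"
  assumes q: "CARD('a) \<ge> 3" and \<pi>: "bij \<pi>" and b: "\<pi> b \<noteq> b"
  shows "card {x. locally_linear (twisted single_twist \<pi>) x} =
    CARD('a) + 1 + 2 * CARD('a) * card {y. \<pi> y = y}"
proof -
  let ?F = "{y. \<pi> y = y}"
  let ?n = "\<lambda>k. card {P. locally_linear (twisted single_twist \<pi>) (k, Some P)}"
  have o1: "CARD('a option) > 1" using q by simp
  have "{P. locally_linear (twisted single_twist \<pi>) (None, Some P)} = {P. dir_label (Some 0) P \<in> ?F}"
    using single_twist_fixed_None[OF \<pi>] single_twist_moved_None[OF q, of \<pi>] by auto
  then have n1: "?n None = card ?F * CARD('a)"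
    using card_label_in[OF parallel_classes_dir_label o1, of "Some 0" ?F] by simp
  have "{P. locally_linear (twisted single_twist \<pi>) (Some 0, Some P)} = {P. dir_label None P \<in> ?F}"
    using single_twist_fixed_Some_0[OF \<pi>] single_twist_moved_Some_0[OF q \<pi>] by auto
  then have n2: "?n (Some 0) = card ?F * CARD('a)"
    using card_label_in[OF parallel_classes_dir_label o1, of None ?F] by simp
  have n3: "?n k = 0" if "k \<notin> {None, Some 0}" for k
    using single_twist_moved_outside[of \<pi> b k, OF q b] that by simp
  have "sum ?n UNIV = sum ?n {None, Some 0}"
    using n3 by (intro sum.mono_neutral_right) auto
  also have "\<dots> = 2 * CARD('a) * card ?F" using n1 n2 by simp
  finally show ?thesis by (simp add: card_glue_vertices locally_linear_clique_point)
qed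

text \<open>Edges inside a plane have the locally linear vertex \<open>p\<^sub>i\<close> as a common neighbour. For an edge between different
planes the twist, which moves every label, spoils the line of \<open>W(q)\<close> through the edge or, if the edge itself
is twisted, the edge has pairwise non-adjacent common neighbours outside the two planes.\<close>

lemma single_twist_no_isolated_line:
  fixes \<pi> :: "'a::{field, finite} \<Rightarrow> 'a"
  assumes q: "CARD('a) \<ge> 3" and \<pi>: "bij \<pi>" and moved: "\<And>y. \<pi> y \<noteq> y"
  shows "\<not> has_isolated_line (twisted single_twist \<pi>)"
proof -
  let ?R = "twisted single_twist \<pi>"
  have half: "\<not> spans_line ?R (e, Some (line_point c e)) (j, Some (line_point c j))"
    if e: "(e = None \<and> e' = Some 0) \<or> (e = Some 0 \<and> e' = None)" and j: "j \<noteq> None" "j \<noteq> Some 0"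
    for e e' j :: "'a option" and c
  proof -
    let ?g = "twisted_label single_twist \<pi>"
    let ?z = "\<lambda>k. (k, Some (line_point c k))"
    obtain k where k: "k \<noteq> None" "k \<noteq> Some 0" "k \<noteq> j" by (rule ex_fresh_option[OF q])
    have ej: "e' \<noteq> j" "e \<noteq> j" "e \<noteq> e'" using e j by auto
    obtain W where W: "?g e' j W = ?g j e' (line_point c j)" "?g e' e W = ?g e e' (line_point c e)"
      by (rule parallel_classes_meet[OF parallel_classes_twisted_label[OF \<pi>], of j e])
        (use ej in auto)
    show ?thesis
    proof (rule not_spans_lineI)
      show "?R (?z e) (e', Some W)" "?R (?z j) (e', Some W)" using W by simp_all
      show "?R (?z e) (?z k)" "?R (?z j) (?z k)"
        by (rule single_twist_untwisted_edge; use k j e in auto)+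
      show "\<not> ?R (e', Some W) (?z k)"
      proof
        assume "?R (e', Some W) (?z k)"
        then have "dir_label k W = dir_label e' (line_point c k)"
          using k e by (auto simp: twisted_label_def single_twist_def)
        moreover have "dir_label j W = dir_label e' (line_point c j)"
          using W(1) j e by (auto simp: twisted_label_def single_twist_def)
        ultimately have "W = line_point c e'" by (intro line_point_unique[OF k(3)])
        then show False using W(2) e moved[of "fst (snd c)"]
          by (auto simp: twisted_label_def single_twist_def line_label)
      qed
    qed
  qed
  have external: "\<not> spans_line ?R (i, Some P) (j, Some Q)"
    if ij: "i \<noteq> j" and adj: "?R (i, Some P) (j, Some Q)" for i j P Q
  proof (cases "{i, j} = {None, Some 0}")
    case True
    then consider "i = None" "j = Some 0" | "i = Some 0" "j = None" using ij by (auto simp: doubleton_eq_iff)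
    then show ?thesis
    proof cases
      case 1
      then show ?thesis using single_twist_bad_edge_twisted[OF q] adj moved single_twist_twisted_edge by metis
    next
      case 2
      then have "?R (None, Some Q) (Some 0, Some P)" using adj glue_sym by metis
      then show ?thesis
        using 2 single_twist_bad_edge_twisted[OF q] moved single_twist_twisted_edge spans_line_sym by metis
    qed
  next
    case False
    then have "dir_label j P = dir_label i Q" using adj by (auto simp: twisted_label_def single_twist_def split: if_splits)
    then obtain c where c: "P = line_point c i" "Q = line_point c j" using line_through[OF ij] by metis
    have "\<not> (i = None \<and> j = Some 0)" "\<not> (i = Some 0 \<and> j = None)" using False by auto
    then consider "i \<noteq> None" "i \<noteq> Some 0" "j \<noteq> None" "j \<noteq> Some 0"
      | "i \<in> {None, Some 0}" "j \<noteq> None" "j \<noteq> Some 0" | "j \<in> {None, Some 0}" "i \<noteq> None" "i \<noteq> Some 0"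
      using ij by (cases "i = None"; cases "i = Some 0"; cases "j = None"; cases "j = Some 0") auto
    then show ?thesis
    proof cases
      case 1
      then show ?thesis unfolding c using moved by (intro single_twist_bad_edge_outside) auto
    next
      case 2
      then show ?thesis unfolding c using half[of i "if i = None then Some 0 else None" j c] by auto
    next
      case 3
      then show ?thesis unfolding c
        using half[of j "if j = None then Some 0 else None" i c] spans_line_sym[of ?R] by auto
    qed
  qed
  show ?thesis
    unfolding has_isolated_line_def
  proof (rule notI, elim exE conjE)
    fix x y
    assume adj: "?R x y" and span: "spans_line ?R x y"
      and none: "\<forall>z. ?R x z \<and> ?R y z \<longrightarrow> \<not> locally_linear ?R z"
    obtain i p j r where xy: "x = (i, p)" "y = (j, r)" by (cases x, cases y)
    have "\<not> locally_linear ?R x" using none adj glue_refl glue_sym by blast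
    then obtain P where p: "p = Some P"
      using xy by (cases p) (simp_all add: locally_linear_clique_point)
    have "\<not> locally_linear ?R y" using none adj glue_refl glue_sym by blast
    then obtain Q where r: "r = Some Q"
      using xy by (cases r) (simp_all add: locally_linear_clique_point)
    show False
    proof (cases "i = j")
      case True
      then show False
        using none[rule_format, of "(i, None)"] by (simp add: xy p r locally_linear_clique_point)
    next
      case False
      then show False using external[of i j P Q] adj span by (simp add: xy p r)
    qed
  qed
qed

section \<open>Twisting two gluings\<close>

text \<open>The two twisted pairs involve four different planes provided that \<open>t\<close> is neither \<open>0\<close> nor \<open>1\<close>. The disjointness
matters for \<open>q = 3\<close>: there a transposition of the non-zero elements is the negation, and as negating the
coordinates of one plane negates all its labels, two twists at a common plane amount to a single one.\<close>

definition double_twist :: "'a::field \<Rightarrow> ('a option \<times> 'a option) set" where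
  "double_twist t = {(None, Some 0), (Some 1, Some t)}"

lemma locally_linearD:
  assumes "locally_linear R x" "R x y" "y \<noteq> x" "R x z" "R y z" "R x w" "R y w"
  shows "R z w"
  using assms unfolding locally_linear_def spans_line_def by blast

text \<open>If the vertex were locally linear, then for suitable neighbours \<open>U\<close>, \<open>V\<close>, \<open>W\<close> in three further planes, with \<open>V\<close>
and \<open>W\<close> adjacent to \<open>U\<close>, also \<open>V\<close> and \<open>W\<close> would be adjacent. Letting \<open>U\<close> vary along its line, this condition
makes \<open>\<pi>\<close> a translation. The three planes are chosen such that exactly one of the adjacencies involves a
twisted pair with an argument that varies with \<open>U\<close>.\<close>

lemma double_twist_bad:
  fixes \<pi> :: "'a::{field, finite} \<Rightarrow> 'a"
  assumes \<pi>: "bij \<pi>" and t: "t \<noteq> 0" "t \<noteq> 1" and transl: "\<And>d. \<exists>y. \<pi> y \<noteq> y + d"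
  shows "\<not> locally_linear (twisted (double_twist t) \<pi>) (i, Some (A, B))"
proof
  let ?R = "twisted (double_twist t) \<pi>"
  note simps = twisted_label_def double_twist_def
  assume good: "locally_linear ?R (i, Some (A, B))"
  note line = locally_linearD[OF good]
  have "\<exists>d. \<forall>y. \<pi> y = y + d"
  proof (cases i)
    case None
    \<comment> \<open>Planes \<open>Some 0\<close>, \<open>Some 1\<close>, \<open>Some t\<close>: the parameter \<open>s\<close> makes \<open>y\<close> the argument of the second twist.\<close>
    have "\<pi> y = y + (\<pi> B + t * (B - A) - t * \<pi> B - B + t * A)" for y
    proof -
      define s where "s = y + \<pi> B + t * (B - A)"
      have "?R (Some 1, Some (B - A, s - \<pi> B)) (Some t, Some (B - t * A, s - t * \<pi> B))"
        by (rule line[of "(Some 0, Some (\<pi> B, s))"]) (use t None in \<open>simp_all add: simps\<close>)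
      then show ?thesis using t by (simp add: simps s_def algebra_simps)
    qed
    then show ?thesis by blast
  next
    case i: (Some k)
    consider "k = 0" | "k = 1" | "k \<noteq> 0" "k \<noteq> 1" by blast
    then show ?thesis
    proof cases
      case 1
      obtain A' where A': "\<pi> A' = A" using \<pi> by (metis bij_pointE)
      \<comment> \<open>Planes \<open>None\<close>, \<open>Some 1\<close>, \<open>Some t\<close>: the parameter \<open>\<alpha>\<close> makes \<open>y\<close> the argument of the second twist.\<close>
      have "\<pi> y = y + (A - t * A - A' + t * A')" for y
      proof -
        define \<alpha> where "\<alpha> = (y - (B - A) + t * A') / t"
        have \<alpha>: "t * \<alpha> = y - (B - A) + t * A'" using t by (simp add: \<alpha>_def)
        have "?R (Some 1, Some (A' - \<alpha>, B - A)) (Some t, Some (A' - t * \<alpha>, B - t * A))"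
          by (rule line[of "(None, Some (\<alpha>, A'))"]) (use t A' i 1 in \<open>simp_all add: simps\<close>)
        then have "\<pi> (B - A - t * (A' - \<alpha>)) = B - t * A - (A' - t * \<alpha>)"
          using t by (simp add: simps)
        moreover have "B - A - t * (A' - \<alpha>) = y" using \<alpha> by (simp add: algebra_simps)
        ultimately show ?thesis using \<alpha> by (simp add: algebra_simps)
      qed
      then show ?thesis by blast
    next
      case 2
      define c where "c = t * A + \<pi> (B - t * A) - B"
      \<comment> \<open>Planes \<open>None\<close>, \<open>Some 0\<close>, \<open>Some t\<close>: the argument of the first twist varies, that of the second does not.\<close>
      have "\<pi> y = y + c / (1 - t)" for y
      proof -
        let ?a = "y - t * (y - A)"
        have "?R (Some 0, Some (\<pi> y, B + \<pi> y)) (Some t, Some (?a, ?a + \<pi> (B - t * A)))"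
          by (rule line[of "(None, Some (y - A, y))"]) (use t i 2 in \<open>simp_all add: simps\<close>)
        then have "B + \<pi> y - t * \<pi> y = ?a + \<pi> (B - t * A)"
          using t by (simp add: simps)
        then have "(1 - t) * \<pi> y = (1 - t) * y + c"
          by (simp add: c_def algebra_simps)
        then show ?thesis using t by (simp add: field_simps)
      qed
      then show ?thesis by blast
    next
      case 3
      \<comment> \<open>Planes \<open>None\<close>, \<open>Some 0\<close>, \<open>Some 1\<close>: only for \<open>k = t\<close> the second twist occurs, with the constant argument \<open>c\<close>.\<close>
      obtain c where c: "(if k = t then \<pi> c else c) = B - A"
        using \<pi> by (metis bij_pointE)
      have "\<pi> y = y + (c + A - B) / (k - 1)" for y
      proof -
        define \<alpha> where "\<alpha> = (y - A) / k"
        have \<alpha>: "y = A + k * \<alpha>" using 3 by (simp add: \<alpha>_def)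
        have "?R (Some 0, Some (\<pi> y, B + k * \<pi> y)) (Some 1, Some (y - \<alpha>, c + k * (y - \<alpha>)))"
          by (rule line[of "(None, Some (\<alpha>, y))"]) (use t i 3 c \<alpha> in \<open>auto simp add: simps\<close>)
        then have "B + k * \<pi> y - \<pi> y = c + k * (y - \<alpha>)"
          using t by (simp add: simps)
        then have "(k - 1) * \<pi> y = (k - 1) * y + (c + A - B)"
          using \<alpha> by (simp add: algebra_simps)
        then show ?thesis using 3 by (simp add: field_simps)
      qed
      then show ?thesis by blast
    qed
  qed
  then show False using transl by metis
qed

text \<open>The points \<open>(0, 0)\<close> of all planes form a clique because \<open>\<pi>\<close> fixes \<open>0\<close>. It has \<open>q + 1\<close> elements, which is the
number of common neighbours of any two vertices, so any two of its points have precisely this clique as their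
closed common neighbourhood.\<close>

lemma double_twist_has_isolated_line:
  fixes \<pi> :: "'a::{field, finite} \<Rightarrow> 'a"
  assumes \<pi>: "bij \<pi>" "\<pi> 0 = 0" and t: "t \<noteq> 0" "t \<noteq> 1" and transl: "\<And>d. \<exists>y. \<pi> y \<noteq> y + d"
  shows "has_isolated_line (twisted (double_twist t) \<pi>)"
proof -
  let ?R = "twisted (double_twist t) \<pi>"
  let ?o = "\<lambda>k. (k, Some (0, 0)) :: 'a option \<times> ('a \<times> 'a) option"
  have dir0: "dir_label k (0, 0) = (0 :: 'a)" for k by (cases k) simp_all
  have clique: "?R (?o k) (?o l)" for k l
    using \<pi>(2) by (simp add: twisted_label_def dir0)
  have common: "{z. ?R (?o None) z \<and> ?R (?o (Some 0)) z} = range ?o"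
  proof (rule card_subset_eq[symmetric])
    show "range ?o \<subseteq> {z. ?R (?o None) z \<and> ?R (?o (Some 0)) z}" using clique by blast
    have "card (range ?o) = CARD('a option)" by (intro card_image) (auto simp: inj_on_def)
    moreover have "card {z. ?R (?o None) z \<and> ?R (?o (Some 0)) z} = CARD('a) + 1"
      by (rule card_glue_common_neighbours[OF parallel_classes_twisted_label[OF \<pi>(1)]]) simp_all
    ultimately show "card (range ?o) = card {z. ?R (?o None) z \<and> ?R (?o (Some 0)) z}" by simp
  qed simp
  have on: "\<exists>k. z = ?o k" if "?R (?o None) z" "?R (?o (Some 0)) z" for z
    using common that by (metis (mono_tags, lifting) mem_Collect_eq rangeE)
  have span: "spans_line ?R (?o None) (?o (Some 0))"
    unfolding spans_line_def using on clique by metis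
  show ?thesis
    unfolding has_isolated_line_def
  proof (intro exI conjI allI impI)
    show "?o None \<noteq> ?o (Some 0)" by simp
    show "?R (?o None) (?o (Some 0))" by (rule clique)
    show "spans_line ?R (?o None) (?o (Some 0))" by (rule span)
    fix z assume "?R (?o None) z \<and> ?R (?o (Some 0)) z"
    then obtain k where "z = ?o k" using on by blast
    then show "\<not> locally_linear ?R z" using double_twist_bad[OF \<pi>(1) t transl] by simp
  qed
qed

lemma card_locally_linear_double_twist:
  fixes \<pi> :: "'a::{field, finite} \<Rightarrow> 'a"
  assumes \<pi>: "bij \<pi>" and t: "t \<noteq> 0" "t \<noteq> 1" and transl: "\<And>d. \<exists>y. \<pi> y \<noteq> y + d"
  shows "card {x. locally_linear (twisted (double_twist t) \<pi>) x} = CARD('a) + 1"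
proof -
  have "\<not> locally_linear (twisted (double_twist t) \<pi>) (k, Some P)" for k P
    using double_twist_bad[OF \<pi> t transl] by (cases P) simp
  then show ?thesis by (simp add: card_glue_vertices locally_linear_clique_point)
qed

section \<open>Permutations with a prescribed number of fixed points\<close>

text \<open>By induction: composing with a transposition of the new element and an old one inserts the new element into
a cycle. If there is only one old element, the transposition alone will do.\<close>

lemma ex_permutation_moving:
  assumes "finite D" "card D \<noteq> 1"
  shows "\<exists>\<pi>. \<pi> permutes D \<and> (\<forall>x\<in>D. \<pi> x \<noteq> x)"
  using assms
proof (induction D rule: finite_induct)
  case empty
  then show ?case using permutes_id by blast
next
  case (insert a D)
  show ?case
  proof (cases "card D = 1")
    case True
    then obtain b where b: "D = {b}" by (rule card_1_singletonE)
    have "Transposition.transpose a b permutes insert a D" using b by (intro permutes_swap_id) auto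
    moreover have "\<forall>x\<in>insert a D. Transposition.transpose a b x \<noteq> x" using b insert.hyps by auto
    ultimately show ?thesis by blast
  next
    case False
    then obtain \<pi> where \<pi>: "\<pi> permutes D" "\<forall>x\<in>D. \<pi> x \<noteq> x" using insert.IH by blast
    have "D \<noteq> {}" using insert.prems insert.hyps by auto
    then obtain b where b: "b \<in> D" by blast
    have a: "\<pi> a = a" using \<pi>(1) insert.hyps(2) by (rule permutes_not_in)
    have "Transposition.transpose a b \<circ> \<pi> permutes insert a D"
      using b by (intro permutes_compose permutes_swap_id permutes_subset[OF \<pi>(1)]) auto
    moreover have "(Transposition.transpose a b \<circ> \<pi>) x \<noteq> x" if "x \<in> insert a D" for x
      using that a b \<pi> insert.hyps(2) permutes_in_image[OF \<pi>(1), of x]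
      by (auto simp: Transposition.transpose_def)
    ultimately show ?thesis by blast
  qed
qed

lemma ex_permutation_with_fixed_points:
  assumes "n + 2 \<le> CARD('a::finite)"
  shows "\<exists>\<pi> :: 'a \<Rightarrow> 'a. bij \<pi> \<and> card {y. \<pi> y = y} = n"
proof -
  obtain F :: "'a set" where F: "card F = n"
    using obtain_subset_with_card_n[of n "UNIV :: 'a set"] assms by auto
  have "card (- F) = CARD('a) - n" using F by (simp add: Compl_eq_Diff_UNIV card_Diff_subset)
  then have "card (- F) \<noteq> 1" using assms by linarith
  then obtain \<pi> where \<pi>: "\<pi> permutes (- F)" "\<forall>x\<in>- F. \<pi> x \<noteq> x"
    using ex_permutation_moving[of "- F"] by auto
  have "{y. \<pi> y = y} = F" using \<pi> permutes_not_in[OF \<pi>(1)] by auto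
  then show ?thesis using F permutes_bij[OF \<pi>(1)] by blast
qed

section \<open>Cospectral mates of W(q)\<close>

lemma isomorphic_graphs_refl:
  assumes "pair_graph G"
  shows "isomorphic_graphs G G"
proof -
  interpret pair_graph G by (rule assms)
  let ?f = "\<lparr> iso_verts = id, iso_arcs = id, iso_head = snd, iso_tail = fst \<rparr>"
  have "digraph_isomorphism ?f"
    using wf_digraph by (auto simp: digraph_isomorphism_def)
  moreover have "with_proj G = app_iso ?f (with_proj G)" by (simp add: app_iso_def with_proj_def)
  ultimately show ?thesis unfolding digraph_iso_def by blast
qed

lemma srg_twisted:
  fixes \<pi> :: "'a::{field, finite} \<Rightarrow> 'a"
  assumes q: "CARD('a) = q" "q \<ge> 3" and \<pi>: "bij \<pi>" and \<phi>: "bij_betw \<phi> V UNIV"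
  shows "srg ((q + 1) * (q\<^sup>2 + 1)) (q * (q + 1)) (q - 1) (q + 1)
           (polarity_graph V (\<lambda>x y. twisted S \<pi> (\<phi> x) (\<phi> y)))"
proof -
  note g = parallel_classes_twisted_label[OF \<pi>, of S]
  have o: "CARD('a option) = q + 1" using q by simp
  have n: "CARD('a option \<times> ('a \<times> 'a) option) = (q + 1) * (q\<^sup>2 + 1)"
    using q(1) by (simp add: card_cartesian_product power2_eq_square)
  have "srg (CARD('a option \<times> ('a \<times> 'a) option)) (q * (q + 1)) (q + 1 - 2) (q + 1)
      (polarity_graph V (\<lambda>x y. twisted S \<pi> (\<phi> x) (\<phi> y)))"
  proof (rule srg_polarity_graph_pullback[OF \<phi>])
    show "card {z. twisted S \<pi> x z} = Suc (q * (q + 1))" for x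
      by (rule card_glue_neighbours[OF g q(1) o]) (use q in simp)
    show "card {z. twisted S \<pi> x z \<and> twisted S \<pi> y z} = q + 1" if "x \<noteq> y" for x y
      by (rule card_glue_common_neighbours[OF g q(1) o _ that]) (use q in simp)
    have "(q + 1) * (q\<^sup>2 + 1) = q * (q + 1) + 1 + q ^ 3"
      by (simp add: algebra_simps eval_nat_numeral)
    then show "q * (q + 1) < CARD('a option \<times> ('a \<times> 'a) option) - 1"
      unfolding n using q(2) by simp
  qed (use q(2) in \<open>auto intro: glue_refl glue_sym\<close>)
  then show ?thesis unfolding n by simp
qed

theorem theorem4p3:
  fixes q :: nat
  assumes "primepow q" and "q \<ge> 3"
    and "CARD('a::{field, finite}) = q"
  shows "\<exists>\<G> :: ('a^4) set pair_pre_digraph set.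
           finite \<G> \<and> card \<G> \<ge> q \<and>
           pairwise (\<lambda>G H. \<not> isomorphic_graphs G H) \<G> \<and>
           (\<forall>G\<in>\<G>. strongly_regular G \<and>
                  cospectral G (W_graph :: ('a^4) set pair_pre_digraph) \<and>
                  \<not> geometric G)"
proof -
  let ?n = "(q + 1) * (q\<^sup>2 + 1)"
  have q: "CARD('a) = q" "CARD('a) \<ge> 3" using assms by simp_all
  have "card (pg3_points :: ('a^4) set set) = CARD('a option \<times> ('a \<times> 'a) option)"
    using card_pg3_points[OF q(1)] q(1) by (simp add: card_cartesian_product power2_eq_square)
  then obtain \<phi> :: "('a^4) set \<Rightarrow> 'a option \<times> ('a \<times> 'a) option" where \<phi>: "bij_betw \<phi> pg3_points UNIV"
    using finite_same_card_bij[OF finite finite] by blast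
  obtain t :: 'a where t: "t \<noteq> 0" "t \<noteq> 1"
  proof -
    have "card {0 :: 'a, 1} < CARD('a)" using q by simp
    then have "{0 :: 'a, 1} \<noteq> UNIV" by (metis less_irrefl)
    then show ?thesis using that by blast
  qed
  \<comment> \<open>Fixing \<open>0\<close>, a translation would be the identity; so any transposition of non-zero elements is suitable.\<close>
  define \<rho> :: "'a \<Rightarrow> 'a" where "\<rho> = Transposition.transpose 1 t"
  have \<rho>: "bij \<rho>" "\<rho> 0 = 0" "\<And>d. \<exists>y. \<rho> y \<noteq> y + d"
  proof -
    show "bij \<rho>" by (simp add: \<rho>_def)
    show \<rho>0: "\<rho> 0 = 0" using t by (simp add: \<rho>_def Transposition.transpose_def)
    have "\<rho> 1 = t" by (simp add: \<rho>_def)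
    then show "\<exists>y. \<rho> y \<noteq> y + d" for d using \<rho>0 t by (metis add.left_neutral add.right_neutral)
  qed
  have "\<forall>n\<in>{..<q - 1}. \<exists>\<pi> :: 'a \<Rightarrow> 'a. bij \<pi> \<and> card {y. \<pi> y = y} = n"
    using ex_permutation_with_fixed_points[where 'a = 'a] q by auto
  from bchoice[OF this] obtain p :: "nat \<Rightarrow> 'a \<Rightarrow> 'a"
    where p: "\<And>n. n < q - 1 \<Longrightarrow> bij (p n)" "\<And>n. n < q - 1 \<Longrightarrow> card {y. p n y = y} = n"
    by blast
  have moved: "\<exists>b. p n b \<noteq> b" if "n < q - 1" for n
  proof (rule ccontr)
    assume "\<nexists>b. p n b \<noteq> b"
    then show False using p(2)[OF that] that q by simp
  qed
  define R where "R n = (if n < q - 1 then twisted single_twist (p n) else twisted (double_twist t) \<rho>)" for n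
  define G where "G n = polarity_graph (pg3_points :: ('a^4) set set) (\<lambda>x y. R n (\<phi> x) (\<phi> y))" for n
  have refl: "R n x x" and sym: "R n x y \<Longrightarrow> R n y x" for n x y
    by (auto simp: R_def intro: glue_refl glue_sym)
  have card_R: "card {x. locally_linear (R n) x} = (if n < q - 1 then q + 1 + 2 * q * n else q + 1)" for n
  proof (cases "n < q - 1")
    case True
    then obtain b where "p n b \<noteq> b" using moved by blast
    then show ?thesis
      using card_locally_linear_single_twist[OF q(2) p(1)[OF True]] p(2)[OF True] True q(1)
      by (simp add: R_def)
  next
    case False
    then show ?thesis using card_locally_linear_double_twist[OF \<rho>(1) t \<rho>(3)] q(1) by (simp add: R_def)
  qed
  have srg: "srg ?n (q * (q + 1)) (q - 1) (q + 1) (G n)" for n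
    using srg_twisted[OF q(1) assms(2) p(1) \<phi>] srg_twisted[OF q(1) assms(2) \<rho>(1) \<phi>]
    by (simp add: G_def R_def)
  have noniso: "\<not> isomorphic_graphs (G n) (G m)" if "n < q" "m < q" "n \<noteq> m" for n m
  proof
    assume "isomorphic_graphs (G n) (G m)"
    then obtain \<psi> where \<psi>: "bij \<psi>" "\<And>x y. R n x y \<longleftrightarrow> R m (\<psi> x) (\<psi> y)"
      unfolding G_def using isomorphic_polarity_graphsD[OF \<phi>, of "R n" "R m"] refl by blast
    have c: "(if n < q - 1 then q + 1 + 2 * q * n else q + 1) = (if m < q - 1 then q + 1 + 2 * q * m else q + 1)"
      using card_locally_linear_iso[of \<psi> "R n" "R m", OF \<psi>] unfolding card_R .
    have h: "has_isolated_line (R n) \<longleftrightarrow> has_isolated_line (R m)"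
      using has_isolated_line_iso[of \<psi> "R n" "R m", OF \<psi>] .
    have double_twist: "has_isolated_line (R (q - 1))"
      using double_twist_has_isolated_line[OF \<rho>(1,2) t \<rho>(3)] by (simp add: R_def)
    have "card {y. p 0 y = y} = 0" using p(2)[of 0] assms(2) by simp
    then have "\<And>y. p 0 y \<noteq> y" by auto
    then have single_twist: "\<not> has_isolated_line (R 0)"
      using single_twist_no_isolated_line[OF q(2) p(1)[of 0]] assms(2) by (simp add: R_def)
    \<comment> \<open>The first invariant confuses only the twist without fixed points and the double twist.\<close>
    have "(n = 0 \<and> m = q - 1) \<or> (n = q - 1 \<and> m = 0)"
      using c that assms(2) by (auto split: if_splits)
    then show False using h double_twist single_twist by auto
  qed
  have props: "strongly_regular (G n)" "cospectral (G n) (W_graph :: ('a^4) set pair_pre_digraph)"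
    "\<not> geometric (G n)" for n
  proof -
    show "strongly_regular (G n)" unfolding strongly_regular_def using srg by blast
    show "cospectral (G n) (W_graph :: ('a^4) set pair_pre_digraph)"
      using srg srg_W_graph[OF q(1)] by (rule srg_same_parameters_cospectral)
    have "\<exists>v. \<not> locally_linear (R n) v"
    proof (cases "n < q - 1")
      case True
      then obtain b where "p n b \<noteq> b" using moved by blast
      then have "\<not> locally_linear (twisted single_twist (p n)) (None, Some (0, b))"
        by (intro single_twist_moved_None[OF q(2)]) simp
      then show ?thesis using True by (auto simp: R_def)
    next
      case False
      then have "\<not> locally_linear (R n) (None, Some (0, 0))"
        using double_twist_bad[OF \<rho>(1) t \<rho>(3)] by (simp add: R_def)
      then show ?thesis by blast
    qed
    then obtain v where "\<not> locally_linear (R n) v" by blast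
    then show "\<not> geometric (G n)"
      unfolding G_def
      by (intro not_geometric_polarity_graph[OF \<phi> _ _ srg[of n, unfolded G_def]])
        (use refl sym assms(2) in auto)
  qed
  have inj: "inj_on G {..<q}"
  proof (rule inj_onI, rule ccontr)
    fix n m assume "n \<in> {..<q}" "m \<in> {..<q}" "G n = G m" "n \<noteq> m"
    moreover have "isomorphic_graphs (G n) (G n)"
      using srg[of n] by (intro isomorphic_graphs_refl) (simp add: srg_def)
    ultimately show False using noniso[of n m] by simp
  qed
  show ?thesis
  proof (intro exI[of _ "G ` {..<q}"] conjI)
    show "card (G ` {..<q}) \<ge> q" using card_image[OF inj] by simp
    show "pairwise (\<lambda>G H. \<not> isomorphic_graphs G H) (G ` {..<q})"
      using noniso by (auto simp: pairwise_def)
  qed (use props in auto)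
qed

end
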